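(* Let $c_1=\frac{40001}{80000}$. For every integer $n\ge 400001$ and every dominating set $C$ of the queen's graph $Q_n$, $$|C|+\delta(C)>c_1 n-2 ,$$ where $$\delta(C)=\min_{p,q\in\{0,1\}}\max\{a_p(C),b_q(C)\},$$ $a_p(C)$ is the number of columns of parity $p$ containing no element of $C$, and $b_q(C)$ is the number of rows of parity $q$ containing no element of $C$.
   Context: The queen's graph $Q_n$ has as vertices the squares $(x,y)\in\{0,\ldots,n-1\}^2$ of the $n\times n$ chessboard ($x$ is the column index, $y$ the row index); two distinct squares are adjacent if they share a row, a column, or a diagonal ($y-x$ equal or $x+y$ equal). A set $C$ of squares is a dominating set if every square belongs to $C$ or is adjacent to a square of $C$. The parity of a row or column is the parity of its index. *)

theory Defs
  imports Complex_Main
begin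

definition dominating_set :: "'v set \<Rightarrow> ('v \<Rightarrow> 'v \<Rightarrow> bool) \<Rightarrow> 'v set \<Rightarrow> bool" where
  "dominating_set V adj C \<longleftrightarrow> C \<subseteq> V \<and> (\<forall>v\<in>V. v \<in> C \<or> (\<exists>c\<in>C. adj v c))"

(* A square is a pair (column, row). *)
definition board :: "nat \<Rightarrow> (nat \<times> nat) set" where
  "board n = {0..<n} \<times> {0..<n}"

(* Difference diagonals are compared over int because subtraction on nat truncates. *)
fun queen_adj :: "nat \<times> nat \<Rightarrow> nat \<times> nat \<Rightarrow> bool" where
  "queen_adj (x, y) (x', y') \<longleftrightarrow>
     (x, y) \<noteq> (x', y') \<and>
     (x = x' \<or> y = y' \<or> int y - int x = int y' - int x' \<or> x + y = x' + y')"

definition queen_dominating :: "nat \<Rightarrow> (nat \<times> nat) set \<Rightarrow> bool" where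
  "queen_dominating n C \<longleftrightarrow> dominating_set (board n) queen_adj C"

definition empty_columns :: "nat \<Rightarrow> (nat \<times> nat) set \<Rightarrow> nat \<Rightarrow> nat" where
  "empty_columns n C p = card {x. x < n \<and> x mod 2 = p \<and> (\<forall>y. (x, y) \<notin> C)}"

definition empty_rows :: "nat \<Rightarrow> (nat \<times> nat) set \<Rightarrow> nat \<Rightarrow> nat" where
  "empty_rows n C q = card {y. y < n \<and> y mod 2 = q \<and> (\<forall>x. (x, y) \<notin> C)}"

definition delta :: "nat \<Rightarrow> (nat \<times> nat) set \<Rightarrow> nat" where
  "delta n C = Min {max (empty_columns n C p) (empty_rows n C q) |p q. p \<in> {0, 1} \<and> q \<in> {0, 1}}"

definition c1 :: real where
  "c1 = 40001 / 80000"

end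

theory Submission
  imports Defs
begin

text \<open>
  Write \<open>\<delta> = max a b\<close>, where \<open>a\<close> counts the empty columns of parity \<open>p\<close> and \<open>b\<close> the empty rows
  of parity \<open>q\<close>, and suppose \<open>|C| + \<delta> \<le> (n - 1)/2 + B\<close> with \<open>B = n/80000 - 3/2\<close>. There are about \<open>n/2\<close>
  columns of parity \<open>p\<close>, so up to \<open>B\<close> exceptions every queen stands in a column of parity \<open>p\<close>, one
  queen in each such column, and likewise for rows. Hence nearly all columns of the other parity are
  empty, nearly all rows of the other parity are empty, and the squares in which they cross have to be
  dominated along diagonals. Such a square and a regular queen (one in a column of parity \<open>p\<close> and a
  row of parity \<open>q\<close>) see the diagonals in different ways: split the relevant difference diagonals and
  the relevant sum diagonals into two classes modulo 4, numbered so that a regular queen lies on two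
  diagonals of the same class; then an empty square lies on two diagonals of different classes.

  Let \<open>d\<^sub>i\<close> be the distance from the centre of the first difference diagonal of class \<open>i\<close> without a queen
  (\<open>gap\<close>). Up to \<open>2B\<close> exceptions, all sum diagonals of class \<open>1 - i\<close> that cross it
  must carry queens. After scaling the board
  to \<open>[-1, 1]\<^sup>2\<close> and putting \<open>w\<^sub>i = 2 d\<^sub>i / n\<close>, queens therefore occupy all difference diagonals of class
  \<open>i\<close> in \<open>[-w\<^sub>i, w\<^sub>i]\<close> and nearly all sum diagonals of class \<open>i\<close> in \<open>[-(2 - w'), 2 - w']\<close> with
  \<open>w'\<close> the value for the other class. This
  already uses up all queens, so the queens nearly form a measure whose marginals in the two coordinates
  and along both kinds of diagonals are known. No such measure exists, and linear programming duality
  supplies the reason: if \<open>hD\<^sub>i(y - x) + hS\<^sub>i(x + y) \<le> f(x) + f(y)\<close> on the square, then summing over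
  the queens bounds the sum of the integrals of the \<open>hD\<^sub>i\<close> and \<open>hS\<^sub>i\<close> over these intervals by four times the integral
  of \<open>f\<close>, up to an error of order \<open>(B + 1)/n\<close> (\<open>certificate_bound\<close>). Three kinds of such inequalities are
  enough.

  \<^item> Constants give \<open>w\<^sub>0 + w\<^sub>1 \<approx> 2\<close>.

  \<^item> The parallelogram law \<open>x\<^sup>2 + y\<^sup>2 = (y - x)\<^sup>2/2 + (x + y)\<^sup>2/2\<close>, used with both signs, then gives
    \<open>(w\<^sub>0 - 1)\<^sup>2 \<approx> 1/3\<close>.

  \<^item> A piecewise quadratic inequality is violated for \<open>w\<^sub>0 \<approx> 1 - 1/\<surd>3\<close>
    (\<open>inner_certificate\<close>, \<open>outer_certificate\<close>, \<open>certificate_gain\<close>), and by symmetry of the two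
    classes for \<open>w\<^sub>0 \<approx> 1 + 1/\<surd>3\<close>.
\<close>

section \<open>Sums of a Lipschitz function over an arithmetic progression\<close>

text \<open>
  A weight \<open>\<phi>\<close> is applied to distances from the centre of the board, so only its values on some
  \<open>[0, \<tau>]\<close> matter. The antiderivative \<open>\<Phi>\<close> replaces the integral.
\<close>

definition profile :: "real \<Rightarrow> (real \<Rightarrow> real) \<Rightarrow> (real \<Rightarrow> real) \<Rightarrow> real \<Rightarrow> real \<Rightarrow> bool" where
  "profile \<tau> \<phi> \<Phi> M L \<longleftrightarrow> 0 < \<tau> \<and> \<Phi> 0 = 0 \<and>
     (\<forall>t\<in>{0..\<tau>}. (\<Phi> has_real_derivative \<phi> t) (at t) \<and> 0 \<le> \<phi> t \<and> \<phi> t \<le> M) \<and>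
     (\<forall>s\<in>{0..\<tau>}. \<forall>t\<in>{0..\<tau>}. \<bar>\<phi> s - \<phi> t\<bar> \<le> L * \<bar>s - t\<bar>)"

lemma profile_lipschitz:
  "profile \<tau> \<phi> \<Phi> M L \<Longrightarrow> s \<in> {0..\<tau>} \<Longrightarrow> t \<in> {0..\<tau>} \<Longrightarrow> \<bar>\<phi> s - \<phi> t\<bar> \<le> L * \<bar>s - t\<bar>"
  unfolding profile_def by blast

lemma profile_L_nonneg:
  assumes "profile \<tau> \<phi> \<Phi> M L"
  shows "0 \<le> L"
proof -
  have "0 < \<tau>" using assms unfolding profile_def by simp
  moreover have "0 \<le> L * \<tau>" using calculation profile_lipschitz[OF assms, of 0 \<tau>] by simp
  ultimately show ?thesis by (simp add: zero_le_mult_iff)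
qed

lemma profile_bounds: "profile \<tau> \<phi> \<Phi> M L \<Longrightarrow> 0 \<le> t \<Longrightarrow> t \<le> \<tau> \<Longrightarrow> 0 \<le> \<phi> t \<and> \<phi> t \<le> M"
  unfolding profile_def by auto

lemma profile_cell:
  assumes "profile \<tau> \<phi> \<Phi> M L" and "0 \<le> s" "s \<le> t" "t \<le> \<tau>"
  shows "\<bar>\<Phi> t - \<Phi> s - (t - s) * \<phi> s\<bar> \<le> L * (t - s)\<^sup>2"
    and "0 \<le> \<Phi> t - \<Phi> s" and "\<Phi> t - \<Phi> s \<le> M * (t - s)"
proof -
  have "\<exists>z. s \<le> z \<and> z \<le> t \<and> \<Phi> t - \<Phi> s = (t - s) * \<phi> z"
  proof (cases "s = t")
    case False
    then have "s < t" using assms by simp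
    moreover have "\<And>x. \<lbrakk>s \<le> x; x \<le> t\<rbrakk> \<Longrightarrow> (\<Phi> has_real_derivative \<phi> x) (at x)"
      using assms unfolding profile_def by auto
    ultimately obtain z where "s < z" "z < t" "\<Phi> t - \<Phi> s = (t - s) * \<phi> z"
      using MVT2[of s t \<Phi> \<phi>] by blast
    then show ?thesis using less_imp_le by blast
  qed auto
  then obtain z where z: "s \<le> z" "z \<le> t" "\<Phi> t - \<Phi> s = (t - s) * \<phi> z" by blast
  have zr: "z \<in> {0..\<tau>}" "s \<in> {0..\<tau>}" using z assms by auto
  have bd: "0 \<le> \<phi> z" "\<phi> z \<le> M" "\<bar>\<phi> z - \<phi> s\<bar> \<le> L * \<bar>z - s\<bar>"
    using assms(1) zr unfolding profile_def by blast+
  have "L * \<bar>z - s\<bar> \<le> L * (t - s)"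
    using z profile_L_nonneg[OF assms(1)] by (intro mult_left_mono) auto
  then have "\<bar>\<phi> z - \<phi> s\<bar> \<le> L * (t - s)" using bd by linarith
  then have "(t - s) * \<bar>\<phi> z - \<phi> s\<bar> \<le> (t - s) * (L * (t - s))"
    using assms by (intro mult_left_mono) auto
  moreover have "\<Phi> t - \<Phi> s - (t - s) * \<phi> s = (t - s) * (\<phi> z - \<phi> s)"
    using z by (simp add: algebra_simps)
  moreover have "\<bar>(t - s) * (\<phi> z - \<phi> s)\<bar> = (t - s) * \<bar>\<phi> z - \<phi> s\<bar>"
    using assms by (simp add: abs_mult)
  moreover have "(t - s) * (L * (t - s)) = L * (t - s)\<^sup>2"
    by (simp add: power2_eq_square)
  ultimately show "\<bar>\<Phi> t - \<Phi> s - (t - s) * \<phi> s\<bar> \<le> L * (t - s)\<^sup>2" by metis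
  show "0 \<le> \<Phi> t - \<Phi> s" using z bd assms by simp
  have "(t - s) * \<phi> z \<le> (t - s) * M" using bd assms by (intro mult_left_mono) auto
  then show "\<Phi> t - \<Phi> s \<le> M * (t - s)" using z by (simp add: mult.commute)
qed

lemma profile_M_nonneg:
  assumes "profile \<tau> \<phi> \<Phi> M L"
  shows "0 \<le> M"
proof -
  have "0 < \<tau>" using assms unfolding profile_def by simp
  then show ?thesis using profile_bounds[OF assms, of 0] by linarith
qed

lemma profile_telescope:
  assumes pr: "profile \<tau> \<phi> \<Phi> M L" and "0 \<le> t0" "0 < \<sigma>" "t0 + \<sigma> * real N \<le> \<tau>"
  shows "\<bar>\<Phi> (t0 + \<sigma> * real N) - \<Phi> t0 - \<sigma> * (\<Sum>j<N. \<phi> (t0 + \<sigma> * real j))\<bar> \<le> real N * (L * \<sigma>\<^sup>2)"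
  using assms(4)
proof (induction N)
  case (Suc N)
  let ?x = "t0 + \<sigma> * real N" and ?y = "t0 + \<sigma> * real (Suc N)"
  have yx: "?y - ?x = \<sigma>" by (simp add: algebra_simps)
  have "?x \<le> ?y" using yx assms by linarith
  have "0 \<le> ?x" using assms by simp
  from profile_cell(1)[OF pr this \<open>?x \<le> ?y\<close> Suc.prems]
  have "\<bar>\<Phi> ?y - \<Phi> ?x - \<sigma> * \<phi> ?x\<bar> \<le> L * \<sigma>\<^sup>2" unfolding yx .
  moreover have "\<bar>\<Phi> ?x - \<Phi> t0 - \<sigma> * (\<Sum>j<N. \<phi> (t0 + \<sigma> * real j))\<bar> \<le> real N * (L * \<sigma>\<^sup>2)"
    using Suc.IH Suc.prems \<open>?x \<le> ?y\<close> by linarith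
  moreover have "real (Suc N) * (L * \<sigma>\<^sup>2) = real N * (L * \<sigma>\<^sup>2) + L * \<sigma>\<^sup>2" by (simp add: algebra_simps)
  moreover have "\<sigma> * (\<Sum>j<Suc N. \<phi> (t0 + \<sigma> * real j)) = \<sigma> * (\<Sum>j<N. \<phi> (t0 + \<sigma> * real j)) + \<sigma> * \<phi> ?x"
    by (simp add: algebra_simps)
  ultimately show ?case by linarith
qed simp

lemma progression_in_interval:
  fixes \<rho> \<sigma> w :: real
  assumes "0 < \<sigma>" "0 \<le> w"
  obtains i0 :: int and N :: nat where
    "{i::int. 0 < \<rho> + \<sigma> * i \<and> \<rho> + \<sigma> * i < w} = (\<lambda>j. i0 + int j) ` {..<N}"
    "0 < \<rho> + \<sigma> * i0" "\<rho> + \<sigma> * i0 \<le> \<sigma>" "w \<le> \<rho> + \<sigma> * i0 + \<sigma> * N"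
    "N = 0 \<or> \<rho> + \<sigma> * i0 + \<sigma> * real (N - 1) < w"
proof -
  define i0 where "i0 = \<lfloor>- \<rho> / \<sigma>\<rfloor> + 1"
  define i1 where "i1 = \<lceil>(w - \<rho>) / \<sigma>\<rceil>"
  define N where "N = nat (i1 - i0)"
  have pos: "0 < \<rho> + \<sigma> * real_of_int i \<longleftrightarrow> i0 \<le> i" for i
  proof -
    have "0 < \<rho> + \<sigma> * real_of_int i \<longleftrightarrow> - \<rho> / \<sigma> < real_of_int i"
      using assms by (auto simp: field_simps)
    also have "\<dots> \<longleftrightarrow> \<lfloor>- \<rho> / \<sigma>\<rfloor> < i" by (simp add: floor_less_iff)
    finally show ?thesis unfolding i0_def by linarith
  qed
  have lt: "\<rho> + \<sigma> * real_of_int i < w \<longleftrightarrow> i < i1" for i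
  proof -
    have "\<rho> + \<sigma> * real_of_int i < w \<longleftrightarrow> real_of_int i < (w - \<rho>) / \<sigma>"
      using assms by (auto simp: field_simps)
    also have "\<dots> \<longleftrightarrow> i < i1" unfolding i1_def by (simp add: less_ceiling_iff)
    finally show ?thesis .
  qed
  have a: "0 < \<rho> + \<sigma> * i0" using pos by simp
  have "\<not> 0 < \<rho> + \<sigma> * real_of_int (i0 - 1)" using pos[of "i0 - 1"] by simp
  then have b: "\<rho> + \<sigma> * i0 \<le> \<sigma>" by (simp add: algebra_simps)
  have "i0 + int N \<ge> i1" unfolding N_def by simp
  then have "\<not> \<rho> + \<sigma> * real_of_int (i0 + int N) < w" using lt[of "i0 + int N"] by (simp only: not_less)
  then have c: "w \<le> \<rho> + \<sigma> * i0 + \<sigma> * N" by (simp add: algebra_simps)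
  have d: "N = 0 \<or> \<rho> + \<sigma> * i0 + \<sigma> * real (N - 1) < w"
  proof (cases "N = 0")
    case False
    have "i0 + int (N - 1) < i1" using False unfolding N_def by simp
    then have "\<rho> + \<sigma> * real_of_int (i0 + int (N - 1)) < w" using lt by blast
    then show ?thesis by (simp add: algebra_simps)
  qed simp
  have e: "{i::int. 0 < \<rho> + \<sigma> * i \<and> \<rho> + \<sigma> * i < w} = (\<lambda>j. i0 + int j) ` {..<N}"
  proof -
    have "{i::int. 0 < \<rho> + \<sigma> * i \<and> \<rho> + \<sigma> * i < w} = {i0..<i1}" using pos lt by auto
    also have "\<dots> = (\<lambda>j. i0 + int j) ` {..<N}"
    proof (intro set_eqI iffI)
      fix i assume i: "i \<in> {i0..<i1}"
      then have "i = i0 + int (nat (i - i0))" "nat (i - i0) < N" unfolding N_def by auto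
      then show "i \<in> (\<lambda>j. i0 + int j) ` {..<N}" by blast
    qed (auto simp: N_def)
    finally show ?thesis .
  qed
  show ?thesis using that[OF e a b c d] .
qed

text \<open>
  The points \<open>\<rho> + \<sigma> i\<close> cut \<open>[0, w]\<close> into cells of length at most \<open>\<sigma>\<close>. Each full cell contributes an
  error of at most \<open>L \<sigma>\<^sup>2\<close>, by the mean value theorem; the term \<open>\<sigma> M\<close> covers the cell before the first
  point (for the lower bound) or the cell after the last one (for the upper bound).
\<close>

lemma riemann_half:
  fixes \<rho> \<sigma> w :: real
  assumes pr: "profile \<tau> \<phi> \<Phi> M L" and "0 < \<sigma>" "0 \<le> w" "w \<le> \<tau>"
  defines "T \<equiv> {i::int. 0 < \<rho> + \<sigma> * i \<and> \<rho> + \<sigma> * i < w}"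
  shows "finite T"
    and "\<bar>\<sigma> * (\<Sum>i\<in>T. \<phi> (\<rho> + \<sigma> * i)) - \<Phi> w\<bar> \<le> \<sigma> * M + L * \<sigma> * (w + \<sigma>)"
proof -
  obtain i0 :: int and N :: nat where
    T0: "{i::int. 0 < \<rho> + \<sigma> * i \<and> \<rho> + \<sigma> * i < w} = (\<lambda>j. i0 + int j) ` {..<N}" and
    i0: "0 < \<rho> + \<sigma> * i0" "\<rho> + \<sigma> * i0 \<le> \<sigma>" and N: "w \<le> \<rho> + \<sigma> * i0 + \<sigma> * N"
    "N = 0 \<or> \<rho> + \<sigma> * i0 + \<sigma> * real (N - 1) < w"
    by (rule progression_in_interval[OF assms(2,3), of \<rho>])
  have T: "T = (\<lambda>j. i0 + int j) ` {..<N}" unfolding T_def by (rule T0)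
  show "finite T" unfolding T by simp
  define t0 where "t0 = \<rho> + \<sigma> * i0"
  have t0: "0 < t0" "t0 \<le> \<sigma>" using i0 unfolding t0_def by auto
  have L0: "0 \<le> L" using profile_L_nonneg[OF pr] .
  have M0: "0 \<le> M" using profile_M_nonneg[OF pr] .
  have Phi0: "\<Phi> 0 = 0" using pr unfolding profile_def by simp
  have sum: "(\<Sum>i\<in>T. \<phi> (\<rho> + \<sigma> * i)) = (\<Sum>j<N. \<phi> (t0 + \<sigma> * real j))"
    unfolding T by (subst sum.reindex) (auto simp: inj_on_def t0_def algebra_simps)
  show "\<bar>\<sigma> * (\<Sum>i\<in>T. \<phi> (\<rho> + \<sigma> * i)) - \<Phi> w\<bar> \<le> \<sigma> * M + L * \<sigma> * (w + \<sigma>)"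
  proof (cases N)
    case 0
    then have w: "w \<le> \<sigma>" using N t0 unfolding t0_def by simp
    have "0 \<le> \<Phi> w" "\<Phi> w \<le> M * w" using profile_cell(2,3)[OF pr, of 0 w] assms Phi0 by auto
    moreover have "M * w \<le> \<sigma> * M" using w M0 by (simp add: mult.commute mult_left_mono)
    moreover have "0 \<le> L * \<sigma> * (w + \<sigma>)" using L0 assms by simp
    ultimately show ?thesis unfolding sum using 0 by simp
  next
    case (Suc m)
    define z where "z = t0 + \<sigma> * real m"
    have z: "z < w" "w \<le> z + \<sigma>" "t0 \<le> z"
      using N Suc assms unfolding t0_def z_def by (auto simp: algebra_simps)
    have tel: "\<bar>\<Phi> z - \<Phi> t0 - \<sigma> * (\<Sum>j<m. \<phi> (t0 + \<sigma> * real j))\<bar> \<le> real m * (L * \<sigma>\<^sup>2)"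
      using profile_telescope[OF pr, of t0 \<sigma> m] t0 z assms unfolding z_def by simp
    have first: "0 \<le> \<Phi> t0" "\<Phi> t0 \<le> M * t0" using profile_cell(2,3)[OF pr, of 0 t0] t0 z assms Phi0 by auto
    have "M * t0 \<le> \<sigma> * M" using t0 M0 by (simp add: mult.commute mult_left_mono)
    have last: "\<bar>\<Phi> w - \<Phi> z - (w - z) * \<phi> z\<bar> \<le> L * (w - z)\<^sup>2" "0 \<le> \<Phi> w - \<Phi> z"
      using profile_cell[OF pr, of z w] t0 z assms by auto
    have phz: "0 \<le> \<phi> z" "\<phi> z \<le> M" using profile_bounds[OF pr, of z] t0 z assms by auto
    have "(w - z) * \<phi> z \<le> \<sigma> * \<phi> z" using z phz by (intro mult_right_mono) auto
    have "(w - z)\<^sup>2 \<le> \<sigma>\<^sup>2" using z by (intro power_mono) auto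
    then have "L * (w - z)\<^sup>2 \<le> L * \<sigma>\<^sup>2" using L0 by (intro mult_left_mono) auto
    have "\<sigma> * \<phi> z \<le> \<sigma> * M" using phz assms by (intro mult_left_mono) auto
    have total: "\<sigma> * (\<Sum>j<N. \<phi> (t0 + \<sigma> * real j))
        = \<sigma> * (\<Sum>j<m. \<phi> (t0 + \<sigma> * real j)) + \<sigma> * \<phi> z"
      using Suc by (simp add: z_def algebra_simps)
    have "\<sigma> * real m \<le> w" using z t0 unfolding z_def by linarith
    then have "(L * \<sigma>) * (\<sigma> * real m) \<le> (L * \<sigma>) * w" using L0 assms by (intro mult_left_mono) auto
    then have "real m * (L * \<sigma>\<^sup>2) + L * \<sigma>\<^sup>2 \<le> L * \<sigma> * (w + \<sigma>)"
      by (simp add: power2_eq_square algebra_simps)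
    moreover have "0 \<le> L * \<sigma>\<^sup>2" using L0 by simp
    ultimately show ?thesis unfolding sum total
      using tel first \<open>M * t0 \<le> \<sigma> * M\<close> last phz \<open>(w - z) * \<phi> z \<le> \<sigma> * \<phi> z\<close>
        \<open>L * (w - z)\<^sup>2 \<le> L * \<sigma>\<^sup>2\<close> \<open>\<sigma> * \<phi> z \<le> \<sigma> * M\<close>
      by linarith
  qed
qed

text \<open>
  Both halves are instances of \<open>riemann_half\<close>; the additional \<open>\<sigma> M\<close> in the upper bound is for a point
  at the centre, which belongs to neither half.
\<close>

lemma riemann_even:
  fixes \<rho> \<sigma> w :: real
  assumes pr: "profile \<tau> \<phi> \<Phi> M L" and "0 < \<sigma>" "0 \<le> w" "w \<le> \<tau>"
  defines "T \<equiv> {i::int. \<bar>\<rho> + \<sigma> * i\<bar> < w}"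
  shows "finite T"
    and "\<sigma> * (\<Sum>i\<in>T. \<phi> \<bar>\<rho> + \<sigma> * i\<bar>) \<ge> 2 * \<Phi> w - 2 * (\<sigma> * M + L * \<sigma> * (w + \<sigma>))"
    and "\<sigma> * (\<Sum>i\<in>T. \<phi> \<bar>\<rho> + \<sigma> * i\<bar>) \<le> 2 * \<Phi> w + 2 * (\<sigma> * M + L * \<sigma> * (w + \<sigma>)) + \<sigma> * M"
proof -
  define P where "P = {i::int. 0 < \<rho> + \<sigma> * i \<and> \<rho> + \<sigma> * i < w}"
  define Q where "Q = {i::int. 0 < - \<rho> + \<sigma> * i \<and> - \<rho> + \<sigma> * i < w}"
  define Q' where "Q' = {i::int. \<rho> + \<sigma> * i < 0 \<and> - w < \<rho> + \<sigma> * i}"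
  define Z where "Z = {i::int. \<rho> + \<sigma> * i = 0 \<and> 0 < w}"
  let ?g = "\<lambda>i::int. \<phi> \<bar>\<rho> + \<sigma> * i\<bar>"
  have Q': "Q' = uminus ` Q"
  proof (intro set_eqI iffI)
    fix i assume "i \<in> Q'"
    then have "- i \<in> Q" unfolding Q_def Q'_def by auto
    then show "i \<in> uminus ` Q" by force
  qed (auto simp: Q_def Q'_def)
  have P1: "finite P" "\<bar>\<sigma> * (\<Sum>i\<in>P. \<phi> (\<rho> + \<sigma> * i)) - \<Phi> w\<bar> \<le> \<sigma> * M + L * \<sigma> * (w + \<sigma>)"
    using riemann_half[OF assms(1-4), of \<rho>] unfolding P_def by auto
  have Q1: "finite Q" "\<bar>\<sigma> * (\<Sum>i\<in>Q. \<phi> (- \<rho> + \<sigma> * i)) - \<Phi> w\<bar> \<le> \<sigma> * M + L * \<sigma> * (w + \<sigma>)"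
    using riemann_half[OF assms(1-4), of "- \<rho>"] unfolding Q_def by auto
  have Z1: "finite Z" "card Z \<le> 1"
  proof -
    have "i = j" if "i \<in> Z" "j \<in> Z" for i j
    proof -
      have "\<sigma> * real_of_int i = \<sigma> * real_of_int j" using that unfolding Z_def by (smt (verit) mem_Collect_eq)
      then show ?thesis using \<open>0 < \<sigma>\<close> by simp
    qed
    then have "\<exists>i. Z \<subseteq> {i}" by blast
    then obtain i where "Z \<subseteq> {i}" by blast
    then show "finite Z" "card Z \<le> 1" using card_mono[of "{i}" Z] finite_subset[of Z "{i}"] by auto
  qed
  have T: "T = (P \<union> Q') \<union> Z" unfolding T_def P_def Q'_def Z_def by auto
  have fin: "finite P" "finite Q'" "finite Z" using P1 Q1 Z1 Q' by auto
  then show "finite T" using T by simp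
  have "sum ?g T = sum ?g (P \<union> Q') + sum ?g Z"
    unfolding T using fin by (intro sum.union_disjoint) (auto simp: P_def Q'_def Z_def)
  also have "sum ?g (P \<union> Q') = sum ?g P + sum ?g Q'"
    using fin by (intro sum.union_disjoint) (auto simp: P_def Q'_def)
  also have "sum ?g P = (\<Sum>i\<in>P. \<phi> (\<rho> + \<sigma> * i))" by (intro sum.cong) (auto simp: P_def)
  also have "sum ?g Q' = (\<Sum>i\<in>Q. \<phi> (- \<rho> + \<sigma> * i))"
    unfolding Q' by (subst sum.reindex) (auto simp: inj_on_def Q_def intro!: sum.cong arg_cong[of _ _ \<phi>])
  finally have eq: "\<sigma> * sum ?g T = \<sigma> * (\<Sum>i\<in>P. \<phi> (\<rho> + \<sigma> * i)) + \<sigma> * (\<Sum>i\<in>Q. \<phi> (- \<rho> + \<sigma> * i)) + \<sigma> * sum ?g Z"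
    by (simp add: algebra_simps)
  have b0: "0 \<le> \<phi> 0" "\<phi> 0 \<le> M" using profile_bounds[OF pr, of 0] assms by auto
  have "sum ?g Z = real (card Z) * \<phi> 0" by (simp add: Z_def)
  moreover have "real (card Z) * \<phi> 0 \<le> 1 * M" using Z1 b0 by (intro mult_mono) auto
  ultimately have "0 \<le> sum ?g Z" "sum ?g Z \<le> M" using b0 by auto
  then have "0 \<le> \<sigma> * sum ?g Z" "\<sigma> * sum ?g Z \<le> \<sigma> * M" using assms by (auto intro: mult_left_mono)
  note Z2 = this
  define e where "e = \<sigma> * M + L * \<sigma> * (w + \<sigma>)"
  note PQ = P1(2)[folded e_def] Q1(2)[folded e_def]
  show "\<sigma> * (\<Sum>i\<in>T. \<phi> \<bar>\<rho> + \<sigma> * i\<bar>) \<ge> 2 * \<Phi> w - 2 * (\<sigma> * M + L * \<sigma> * (w + \<sigma>))"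
    unfolding e_def[symmetric] using PQ eq Z2 by linarith
  show "\<sigma> * (\<Sum>i\<in>T. \<phi> \<bar>\<rho> + \<sigma> * i\<bar>) \<le> 2 * \<Phi> w + 2 * (\<sigma> * M + L * \<sigma> * (w + \<sigma>)) + \<sigma> * M"
    unfolding e_def[symmetric] using PQ eq Z2 by linarith
qed

text \<open>
  The form in which lines and diagonals occur: \<open>k\<close> is the index of a line, \<open>a/2\<close> the index of the
  central one. On the scaled board neighbouring lines of the class have distance \<open>2m/n\<close>.
\<close>

lemma residue_class_sum:
  fixes m r a b :: int and n :: nat
  assumes pr: "profile \<tau> \<phi> \<Phi> M L" and "0 < m" "0 < n" "0 \<le> b" "real_of_int b \<le> \<tau> * real n"
  defines "S \<equiv> {k::int. k mod m = r mod m \<and> \<bar>2 * k - a\<bar> < b}"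
  defines "E \<equiv> L * (real_of_int b / n + 2 * real_of_int m / n)"
  shows "finite S"
    and "(\<Sum>k\<in>S. \<phi> (\<bar>real_of_int (2 * k - a)\<bar> / n)) \<ge> n / m * \<Phi> (real_of_int b / n) - 2 * M - 2 * E"
    and "(\<Sum>k\<in>S. \<phi> (\<bar>real_of_int (2 * k - a)\<bar> / n)) \<le> n / m * \<Phi> (real_of_int b / n) + 3 * M + 2 * E"
proof -
  define \<sigma> where "\<sigma> = 2 * real_of_int m / n"
  define \<rho> where "\<rho> = real_of_int (2 * r - a) / n"
  define w where "w = real_of_int b / n"
  define T where "T = {i::int. \<bar>\<rho> + \<sigma> * i\<bar> < w}"
  have s: "0 < \<sigma>" "0 \<le> w" "w \<le> \<tau>" using assms unfolding \<sigma>_def w_def by (auto simp: divide_simps)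
  have conv: "\<bar>real_of_int (2 * (r + m * i) - a)\<bar> / n = \<bar>\<rho> + \<sigma> * i\<bar>" for i
  proof -
    have "\<rho> + \<sigma> * i = real_of_int (2 * (r + m * i) - a) / n"
      unfolding \<rho>_def \<sigma>_def by (simp add: add_divide_distrib diff_divide_distrib algebra_simps)
    then show ?thesis by simp
  qed
  have memb: "r + m * i \<in> S \<longleftrightarrow> i \<in> T" for i
  proof -
    have "\<bar>\<rho> + \<sigma> * i\<bar> < w \<longleftrightarrow> \<bar>real_of_int (2 * (r + m * i) - a)\<bar> < real_of_int b"
      unfolding conv[symmetric] w_def using assms by (simp add: divide_less_cancel)
    also have "\<dots> \<longleftrightarrow> \<bar>2 * (r + m * i) - a\<bar> < b" by linarith
    finally show ?thesis unfolding S_def T_def by simp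
  qed
  have S: "S = (\<lambda>i. r + m * i) ` T"
  proof (intro set_eqI iffI)
    fix k assume k: "k \<in> S"
    then have "m dvd k - r" unfolding S_def by (simp add: mod_eq_dvd_iff)
    then obtain i where "k = r + m * i" by (metis dvdE add_diff_cancel_left' diff_add_cancel add.commute)
    then show "k \<in> (\<lambda>i. r + m * i) ` T" using k memb by auto
  qed (use memb in auto)
  have fin: "finite T" unfolding T_def by (rule riemann_even(1)[OF pr s])
  then show "finite S" using S by simp
  have sum: "(\<Sum>k\<in>S. \<phi> (\<bar>real_of_int (2 * k - a)\<bar> / n)) = (\<Sum>i\<in>T. \<phi> \<bar>\<rho> + \<sigma> * i\<bar>)"
    unfolding S using \<open>0 < m\<close>
    by (subst sum.reindex) (auto simp: inj_on_def conv[symmetric] intro!: sum.cong)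
  have E: "E = L * (w + \<sigma>)" unfolding E_def w_def \<sigma>_def ..
  have lo: "\<sigma> * (\<Sum>i\<in>T. \<phi> \<bar>\<rho> + \<sigma> * i\<bar>) \<ge> \<sigma> * (n / m * \<Phi> w - 2 * M - 2 * E)"
  proof -
    have "\<sigma> * (n / m * \<Phi> w - 2 * M - 2 * E) = 2 * \<Phi> w - 2 * (\<sigma> * M + L * \<sigma> * (w + \<sigma>))"
      unfolding E using assms by (simp add: \<sigma>_def field_simps)
    then show ?thesis using riemann_even(2)[OF pr s, of \<rho>] unfolding T_def by linarith
  qed
  have hi: "\<sigma> * (\<Sum>i\<in>T. \<phi> \<bar>\<rho> + \<sigma> * i\<bar>) \<le> \<sigma> * (n / m * \<Phi> w + 3 * M + 2 * E)"
  proof -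
    have "\<sigma> * (n / m * \<Phi> w + 3 * M + 2 * E) = 2 * \<Phi> w + 2 * (\<sigma> * M + L * \<sigma> * (w + \<sigma>)) + \<sigma> * M"
      unfolding E using assms by (simp add: \<sigma>_def field_simps)
    then show ?thesis using riemann_even(3)[OF pr s, of \<rho>] unfolding T_def by linarith
  qed
  show "(\<Sum>k\<in>S. \<phi> (\<bar>real_of_int (2 * k - a)\<bar> / n)) \<ge> n / m * \<Phi> (real_of_int b / n) - 2 * M - 2 * E"
    unfolding sum using lo s mult_le_cancel_left_pos unfolding w_def by blast
  show "(\<Sum>k\<in>S. \<phi> (\<bar>real_of_int (2 * k - a)\<bar> / n)) \<le> n / m * \<Phi> (real_of_int b / n) + 3 * M + 2 * E"
    unfolding sum using hi s mult_le_cancel_left_pos unfolding w_def by blast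
qed

section \<open>Queens, lines and diagonals\<close>

lemma sum_le_sum_over_preimage:
  fixes h :: "'b \<Rightarrow> real"
  assumes "finite R" "finite T" "finite Z" "T \<subseteq> \<psi> ` R \<union> Z"
    and "\<And>x. x \<in> T \<Longrightarrow> h x \<le> M" "0 \<le> M" "\<And>r. r \<in> R \<Longrightarrow> 0 \<le> h (\<psi> r)"
  shows "sum h T \<le> (\<Sum>r\<in>R. h (\<psi> r)) + M * card Z"
proof -
  have "sum h T = sum h (T \<inter> \<psi> ` R) + sum h (T - \<psi> ` R)"
    using assms(2) by (subst sum.Int_Diff[of T _ "\<psi> ` R"]) auto
  moreover have "sum h (T \<inter> \<psi> ` R) \<le> sum h (\<psi> ` R)"
    using assms by (intro sum_mono2) auto
  moreover have "sum h (\<psi> ` R) \<le> sum (h \<circ> \<psi>) R"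
    using assms by (intro sum_image_le) auto
  moreover have "sum h (T - \<psi> ` R) \<le> of_nat (card (T - \<psi> ` R)) * M"
    using assms by (intro sum_bounded_above) auto
  moreover have "real (card (T - \<psi> ` R)) * M \<le> real (card Z) * M"
    using assms by (intro mult_right_mono of_nat_mono card_mono) auto
  ultimately show ?thesis by (simp add: o_def mult.commute)
qed

lemma card_parity_class_ge:
  assumes "p < (2::nat)"
  shows "real (card {x. x < n \<and> x mod 2 = p}) \<ge> (real n - 1) / 2"
proof -
  have "{x. x < n \<and> x mod 2 = p} = (\<lambda>i. 2 * i + p) ` {..<(n + 1 - p) div 2}"
  proof (intro set_eqI iffI)
    fix x assume x: "x \<in> {x. x < n \<and> x mod 2 = p}"
    then have eq: "x = 2 * (x div 2) + p" by auto
    then have "2 * (x div 2) + p < n" using x by simp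
    then have "2 * Suc (x div 2) \<le> n + 1 - p" by simp
    then have "Suc (x div 2) \<le> (n + 1 - p) div 2" by (simp add: less_eq_div_iff_mult_less_eq)
    then have "x div 2 < (n + 1 - p) div 2" by simp
    with eq show "x \<in> (\<lambda>i. 2 * i + p) ` {..<(n + 1 - p) div 2}" by blast
  next
    fix x assume "x \<in> (\<lambda>i. 2 * i + p) ` {..<(n + 1 - p) div 2}"
    then show "x \<in> {x. x < n \<and> x mod 2 = p}" using assms by auto
  qed
  then have "card {x. x < n \<and> x mod 2 = p} = (n + 1 - p) div 2"
    by (simp add: card_image inj_on_def)
  moreover have "n \<le> 2 * ((n + 1 - p) div 2) + 1" using assms by auto
  ultimately have "n \<le> 2 * card {x. x < n \<and> x mod 2 = p} + 1" by metis
  then have "real n \<le> real (2 * card {x. x < n \<and> x mod 2 = p} + 1)" by (rule of_nat_mono)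
  then show ?thesis by simp
qed

text \<open>
  Choose one queen in each occupied line of parity \<open>p\<close>. As there are at least \<open>(n - 1)/2\<close> lines of this
  parity, at most \<open>B\<close> queens are left over. They include all queens in lines of the wrong parity.
\<close>

lemma excess_over_lines:
  fixes g :: "nat \<Rightarrow> real" and \<pi> :: "'a \<Rightarrow> nat"
  assumes "finite C" "p < 2" "\<pi> ` C \<subseteq> {..<n}"
    and "real (card C) + real (card {x. x < n \<and> x mod 2 = p \<and> x \<notin> \<pi> ` C}) \<le> (real n - 1) / 2 + B"
  shows "real (card {c\<in>C. \<pi> c mod 2 \<noteq> p}) \<le> B"
    and "\<lbrakk>0 \<le> M; \<And>x. x < n \<Longrightarrow> 0 \<le> g x \<and> g x \<le> M\<rbrakk> \<Longrightarrow>
      (\<Sum>c\<in>C. g (\<pi> c)) \<le> (\<Sum>x | x < n \<and> x mod 2 = p. g x) + B * M"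
proof -
  define X where "X = {x. x < n \<and> x mod 2 = p}"
  define Y where "Y = X \<inter> \<pi> ` C"
  have "finite X" unfolding X_def by simp
  have "{x. x < n \<and> x mod 2 = p \<and> x \<notin> \<pi> ` C} = X - \<pi> ` C" unfolding X_def by auto
  moreover have "real (card X) = real (card Y) + real (card (X - \<pi> ` C))"
    unfolding Y_def using \<open>finite X\<close> card_Un_disjoint[of "X \<inter> \<pi> ` C" "X - \<pi> ` C"]
    by (simp add: Int_Diff_Un Int_Diff_disjoint)
  moreover have "real (card X) \<ge> (real n - 1) / 2"
    unfolding X_def using card_parity_class_ge[OF assms(2)] .
  moreover note assms(4)
  ultimately have excess: "real (card C) - real (card Y) \<le> B" by (simp add: field_simps)
  have "Y \<subseteq> \<pi> ` {c\<in>C. \<pi> c mod 2 = p}" unfolding Y_def X_def by auto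
  then obtain R where R: "R \<subseteq> {c\<in>C. \<pi> c mod 2 = p}" "inj_on \<pi> R" "Y = \<pi> ` R"
    unfolding subset_image_inj by blast
  have finR: "finite R" using R(1) assms(1) finite_subset by fastforce
  have cardR: "card R = card Y" using R(2,3) card_image by metis
  have RC: "R \<subseteq> C" using R(1) by auto
  have cardD: "real (card (C - R)) = real (card C) - real (card Y)"
    using RC finR cardR card_mono[OF assms(1) RC] by (simp add: card_Diff_subset of_nat_diff)
  have "{c\<in>C. \<pi> c mod 2 \<noteq> p} \<subseteq> C - R" using R(1) by auto
  then have "card {c\<in>C. \<pi> c mod 2 \<noteq> p} \<le> card (C - R)" using assms(1) by (intro card_mono) auto
  then show "real (card {c\<in>C. \<pi> c mod 2 \<noteq> p}) \<le> B" using cardD excess by linarith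
  assume M: "0 \<le> M" and g: "\<And>x. x < n \<Longrightarrow> 0 \<le> g x \<and> g x \<le> M"
  have lt: "\<pi> c < n" if "c \<in> C" for c using that assms(3) by auto
  have "(\<Sum>c\<in>C. g (\<pi> c)) = (\<Sum>c\<in>R. g (\<pi> c)) + (\<Sum>c\<in>C - R. g (\<pi> c))"
    using RC assms(1) by (metis add.commute sum.subset_diff)
  moreover have "(\<Sum>c\<in>R. g (\<pi> c)) = sum g Y" unfolding R(3) using R(2) by (simp add: sum.reindex)
  moreover have "sum g Y \<le> sum g X"
    using \<open>finite X\<close> g unfolding Y_def X_def by (intro sum_mono2) auto
  moreover have "(\<Sum>c\<in>C - R. g (\<pi> c)) \<le> of_nat (card (C - R)) * M"
    using g lt by (intro sum_bounded_above) auto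
  moreover have "real (card (C - R)) * M \<le> B * M"
    using cardD excess M by (intro mult_right_mono) auto
  ultimately show "(\<Sum>c\<in>C. g (\<pi> c)) \<le> (\<Sum>x | x < n \<and> x mod 2 = p. g x) + B * M"
    unfolding X_def by linarith
qed

fun diag :: "nat \<times> nat \<Rightarrow> int" where "diag (x, y) = int y - int x"
fun anti :: "nat \<times> nat \<Rightarrow> int" where "anti (x, y) = int x + int y"

text \<open>
  The number \<open>B\<close> measures how far \<open>C\<close> is from having exactly one queen in each column of parity \<open>p\<close>,
  exactly one in each row of parity \<open>q\<close>, and no others.
\<close>

locale near_parity_cover =
  fixes n :: nat and C :: "(nat \<times> nat) set" and p q :: nat and B :: real
  assumes dom: "queen_dominating n C"
    and n_pos: "0 < n" and p_lt: "p < 2" and q_lt: "q < 2"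
    and columns: "real (card C) + real (empty_columns n C p) \<le> (real n - 1) / 2 + B"
    and rows: "real (card C) + real (empty_rows n C q) \<le> (real n - 1) / 2 + B"
begin

text \<open>
  A square in a column of parity \<open>p\<close> and a row of parity \<open>q\<close> has difference \<open>q - p\<close> and sum \<open>p + q\<close>
  modulo 2, so both kinds of diagonals split into the classes \<open>0\<close> and \<open>1\<close>. The offsets are chosen
  to make the two classes agree on such squares; on squares with both parities changed they differ.
\<close>

definition diag_class :: "int \<Rightarrow> int set" where
  "diag_class c = {k. k mod 4 = (int q - int p + 2 * c) mod 4}"

definition anti_class :: "int \<Rightarrow> int set" where
  "anti_class c = {l. l mod 4 = (int p + int q + 2 * c) mod 4}"

definition irregular :: "(nat \<times> nat) set" where
  "irregular = {c\<in>C. fst c mod 2 \<noteq> p} \<union> {c\<in>C. snd c mod 2 \<noteq> q}"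

lemma C_board: "C \<subseteq> board n"
  using dom unfolding queen_dominating_def dominating_set_def by blast

lemma finite_C: "finite C"
  by (rule finite_subset[OF C_board]) (simp add: board_def)

lemma coords_lt: "c \<in> C \<Longrightarrow> fst c < n \<and> snd c < n"
  using C_board unfolding board_def by auto

lemma column_deficit:
  "real (card C) + real (card {x. x < n \<and> x mod 2 = p \<and> x \<notin> fst ` C}) \<le> (real n - 1) / 2 + B"
proof -
  have "{x. x < n \<and> x mod 2 = p \<and> x \<notin> fst ` C} = {x. x < n \<and> x mod 2 = p \<and> (\<forall>y. (x, y) \<notin> C)}"
    by force
  then show ?thesis using columns unfolding empty_columns_def by simp
qed

lemma row_deficit:
  "real (card C) + real (card {x. x < n \<and> x mod 2 = q \<and> x \<notin> snd ` C}) \<le> (real n - 1) / 2 + B"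
proof -
  have "{x. x < n \<and> x mod 2 = q \<and> x \<notin> snd ` C} = {y. y < n \<and> y mod 2 = q \<and> (\<forall>x. (x, y) \<notin> C)}"
    by force
  then show ?thesis using rows unfolding empty_rows_def by simp
qed

lemma coords_subset: "fst ` C \<subseteq> {..<n}" "snd ` C \<subseteq> {..<n}"
  using coords_lt by auto

lemmas column_excess = excess_over_lines[OF finite_C p_lt coords_subset(1) column_deficit]
lemmas row_excess = excess_over_lines[OF finite_C q_lt coords_subset(2) row_deficit]

lemma finite_irregular: "finite irregular"
  using finite_C unfolding irregular_def by simp

lemma card_irregular: "real (card irregular) \<le> 2 * B"
proof -
  have "card irregular \<le> card {c\<in>C. fst c mod 2 \<noteq> p} + card {c\<in>C. snd c mod 2 \<noteq> q}"
    unfolding irregular_def by (rule card_Un_le)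
  then show ?thesis using column_excess(1) row_excess(1) by linarith
qed

lemma B_nonneg: "0 \<le> B"
  using card_irregular by (meson of_nat_0_le_iff order_trans zero_le_mult_iff zero_less_numeral not_less)

text \<open>
  Sum and difference of the coordinates differ by \<open>2x\<close>, which is \<open>2p\<close> modulo 4.
\<close>

lemma diag_class_iff_anti_class:
  assumes "c \<in> C - irregular"
  shows "diag c \<in> diag_class i \<longleftrightarrow> anti c \<in> anti_class i"
proof -
  obtain x y where c: "c = (x, y)" by (cases c)
  have "x mod 2 = p" "y mod 2 = q" using assms unfolding irregular_def c by auto
  then obtain a b where "x = 2 * a + p" "y = 2 * b + q" by (metis mult_div_mod_eq)
  then show ?thesis unfolding c diag_class_def anti_class_def mem_Collect_eq mod_eq_dvd_iff
    by simp presburger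
qed

text \<open>
  The diagonals \<open>k\<close> and \<open>l\<close> meet in a square \<open>(x, x + k)\<close> with \<open>2x = l - k\<close>. The classes force \<open>x\<close> and
  \<open>x + k\<close> to have the wrong parities, and the inequality puts the square on the board. No queen
  dominates it diagonally, so one does along its column or its row.
\<close>

lemma undominated_anti_line:
  assumes "k \<in> diag_class i" "k \<notin> diag ` C" "l \<in> anti_class (1 - i)" "l \<notin> anti ` C"
    and "\<bar>l - (int n - 1)\<bar> < int n - \<bar>k\<bar>"
  shows "nat ((l - k) div 2) \<in> fst ` {c\<in>C. fst c mod 2 \<noteq> p} \<or>
    nat ((l - k) div 2) \<in> (\<lambda>c. nat (int (snd c) - k)) ` {c\<in>C. snd c mod 2 \<noteq> q}"
    and "even (l - k)" "0 \<le> l - k"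
proof -
  define x where "x = (l - k) div 2"
  have "4 dvd l - k - 2 * int p - 2 + 4 * i"
  proof -
    have "4 dvd k - (int q - int p + 2 * i)" "4 dvd l - (int p + int q + 2 * (1 - i))"
      using assms(1,3) unfolding diag_class_def anti_class_def by (simp_all add: mod_eq_dvd_iff)
    then have "4 dvd (l - (int p + int q + 2 * (1 - i))) - (k - (int q - int p + 2 * i))" by (rule dvd_diff[rotated])
    moreover have "(l - (int p + int q + 2 * (1 - i))) - (k - (int q - int p + 2 * i)) = l - k - 2 * int p - 2 + 4 * i"
      by simp
    ultimately show ?thesis by metis
  qed
  then obtain t where t: "l - k - 2 * int p - 2 + 4 * i = 4 * t" by (rule dvdE)
  then have "l - k = 2 * (int p + 1 + 2 * (t - i))" by simp
  then have x2: "l - k = 2 * x" "x = int p + 1 + 2 * (t - i)" unfolding x_def by simp_all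
  then show "even (l - k)" by simp
  have "4 dvd k - (int q - int p + 2 * i)"
    using assms(1) unfolding diag_class_def by (simp add: mod_eq_dvd_iff)
  then obtain t' where "k - (int q - int p + 2 * i) = 4 * t'" by (rule dvdE)
  then have y: "x + k = int q + 1 + 2 * (t + 2 * t')" using x2(2) by simp
  have range: "0 \<le> x" "x < int n" "0 \<le> x + k" "x + k < int n"
    using assms(5) x2(1) by linarith+
  then show "0 \<le> l - k" using x2 by simp
  define a b where "a = nat x" and "b = nat (x + k)"
  have ab: "int a = x" "int b = x + k" "a < n" "b < n" using range unfolding a_def b_def by auto
  have par: "a mod 2 \<noteq> p" "b mod 2 \<noteq> q" 
  proof -
    have "int a - int p = 2 * (t - i) + 1" "int b - int q = 2 * (t + 2 * t') + 1"
      using ab x2(2) y by linarith+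
    then have "odd (int a - int p)" "odd (int b - int q)" by simp_all
    then show "a mod 2 \<noteq> p" "b mod 2 \<noteq> q" by presburger+
  qed
  have "(a, b) \<notin> C" using assms(2) ab by force
  moreover have "(a, b) \<in> board n" using ab unfolding board_def by simp
  ultimately obtain c where c: "c \<in> C" "queen_adj (a, b) c"
    using dom unfolding queen_dominating_def dominating_set_def by blast
  obtain u v where uv: "c = (u, v)" by (cases c)
  have "int b - int a = k" "int a + int b = l" using ab x2 by auto
  then have "int v - int u \<noteq> int b - int a" "int u + int v \<noteq> int a + int b"
    using assms(2,4) c(1) uv by force+
  then have "a = u \<or> b = v" using c(2) uv by auto
  then show "nat ((l - k) div 2) \<in> fst ` {c\<in>C. fst c mod 2 \<noteq> p} \<or>
    nat ((l - k) div 2) \<in> (\<lambda>c. nat (int (snd c) - k)) ` {c\<in>C. snd c mod 2 \<noteq> q}"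
  proof
    assume "a = u"
    then have "nat x \<in> fst ` {c\<in>C. fst c mod 2 \<noteq> p}" using c(1) uv par a_def by force
    then show ?thesis unfolding x_def by simp
  next
    assume "b = v"
    then have "nat x = nat (int (snd c) - k)" using uv ab by simp
    moreover have "c \<in> {c\<in>C. snd c mod 2 \<noteq> q}" using c(1) uv par \<open>b = v\<close> by simp
    ultimately show ?thesis unfolding x_def by blast
  qed
qed

text \<open>
  The number \<open>d\<close> is the distance from the centre of the first difference diagonal of class \<open>i\<close> without
  a queen, or \<open>n\<close> if there is none. The bound on sum diagonals of the other class is what domination of
  the squares on that diagonal yields.
\<close>

definition gap :: "int \<Rightarrow> int \<Rightarrow> bool" where
  "gap i d \<longleftrightarrow> 0 \<le> d \<and> d \<le> int n \<and> (\<forall>k\<in>diag_class i. \<bar>k\<bar> < d \<longrightarrow> k \<in> diag ` C) \<and>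
    real (card {l \<in> anti_class (1 - i). \<bar>l - (int n - 1)\<bar> < int n - d \<and> l \<notin> anti ` C}) \<le> 2 * B"

lemma gap_exists: "\<exists>d. gap i d"
proof (cases "\<exists>k. k \<in> diag_class i \<and> k \<notin> diag ` C \<and> \<bar>k\<bar> < int n")
  case False
  have "{l \<in> anti_class (1 - i). \<bar>l - (int n - 1)\<bar> < int n - int n \<and> l \<notin> anti ` C} = {}" by auto
  then have "gap i (int n)" unfolding gap_def using False B_nonneg by auto
  then show ?thesis ..
next
  case True
  define P where "P k \<longleftrightarrow> k \<in> diag_class i \<and> k \<notin> diag ` C \<and> \<bar>k\<bar> < int n" for k
  have "\<exists>k. P k" using True unfolding P_def .
  then obtain k where k: "P k" "\<And>k'. P k' \<Longrightarrow> nat \<bar>k\<bar> \<le> nat \<bar>k'\<bar>"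
    using ex_has_least_nat[of P _ "\<lambda>k. nat \<bar>k\<bar>"] by blast
  define U where "U = {l \<in> anti_class (1 - i). \<bar>l - (int n - 1)\<bar> < int n - \<bar>k\<bar> \<and> l \<notin> anti ` C}"
  define W where "W = fst ` {c\<in>C. fst c mod 2 \<noteq> p} \<union> (\<lambda>c. nat (int (snd c) - k)) ` {c\<in>C. snd c mod 2 \<noteq> q}"
  have kP: "k \<in> diag_class i" "k \<notin> diag ` C" using k(1) unfolding P_def by auto
  have inj: "inj_on (\<lambda>l. nat ((l - k) div 2)) U"
  proof (rule inj_onI)
    fix l l' assume l: "l \<in> U" "l' \<in> U" "nat ((l - k) div 2) = nat ((l' - k) div 2)"
    have "even (l - k)" "0 \<le> l - k" "even (l' - k)" "0 \<le> l' - k"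
      using undominated_anti_line(2,3)[OF kP] l(1,2) unfolding U_def by auto
    moreover have "(l - k) div 2 = (l' - k) div 2"
      using l(3) calculation by (simp add: nat_eq_iff2)
    ultimately show "l = l'" by (metis add_diff_cancel diff_add_cancel dvd_div_mult_self)
  qed
  have sub: "(\<lambda>l. nat ((l - k) div 2)) ` U \<subseteq> W"
    using undominated_anti_line(1)[OF kP] unfolding U_def W_def by blast
  have "finite W" unfolding W_def using finite_C by simp
  then have "card U \<le> card W" using card_inj_on_le[OF inj sub] by simp
  also have "card W \<le> card {c\<in>C. fst c mod 2 \<noteq> p} + card {c\<in>C. snd c mod 2 \<noteq> q}"
    unfolding W_def using finite_C
    by (intro order_trans[OF card_Un_le] add_mono card_image_le) auto
  finally have "real (card U) \<le> 2 * B" using column_excess(1) row_excess(1) by linarith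
  moreover have "k' \<in> diag ` C" if "k' \<in> diag_class i" "\<bar>k'\<bar> < \<bar>k\<bar>" for k'
  proof (rule ccontr)
    assume "k' \<notin> diag ` C"
    then have "P k'" using that k(1) unfolding P_def by auto
    then show False using k(2)[of k'] that by linarith
  qed
  ultimately have "gap i \<bar>k\<bar>" using k(1) unfolding U_def P_def gap_def by auto
  then show ?thesis ..
qed

text \<open>
  Sum the certificate over the regular queens. By \<open>excess_over_lines\<close> the column and the row weights
  exceed one weight per line by at most \<open>B M\<close> each. Conversely, a diagonal counted on the left is missed by
  the regular queens only if it carries one of the at most \<open>2B\<close> irregular queens or is one of the at most
  \<open>2B\<close> exceptional sum diagonals of its class. Altogether the losses are \<open>2 + 4 \<cdot> 2 + 2 \<cdot> 2 = 14\<close> times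
  \<open>B M\<close>.
\<close>

lemma discrete_certificate:
  fixes u v :: "nat \<Rightarrow> real" and gD gS :: "int \<Rightarrow> int \<Rightarrow> real" and d :: "int \<Rightarrow> int"
  assumes M: "0 \<le> M"
    and u: "\<And>x. x < n \<Longrightarrow> 0 \<le> u x \<and> u x \<le> M" and v: "\<And>x. x < n \<Longrightarrow> 0 \<le> v x \<and> v x \<le> M"
    and gD: "\<And>i k. \<bar>k\<bar> < int n \<Longrightarrow> 0 \<le> gD i k \<and> gD i k \<le> M"
    and gS: "\<And>i l. \<bar>l - (int n - 1)\<bar> < int n \<Longrightarrow> 0 \<le> gS i l \<and> gS i l \<le> M"
    and certificate: "\<And>i x y. \<lbrakk>i \<in> {0, 1}; x < n; y < n\<rbrakk> \<Longrightarrow>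
      gD i (int y - int x) + gS i (int x + int y) \<le> u x + v y"
    and gap: "\<And>i. i \<in> {0, 1} \<Longrightarrow> gap i (d i)"
  shows "(\<Sum>i\<in>{0, 1}. (\<Sum>k | k \<in> diag_class i \<and> \<bar>k\<bar> < d i. gD i k)
      + (\<Sum>l | l \<in> anti_class i \<and> \<bar>l - (int n - 1)\<bar> < int n - d (1 - i). gS i l))
    \<le> (\<Sum>x | x < n \<and> x mod 2 = p. u x) + (\<Sum>y | y < n \<and> y mod 2 = q. v y) + 14 * B * M"
proof -
  have d: "0 \<le> d i" "d i \<le> int n"
    and d_diag: "\<And>k. \<lbrakk>k \<in> diag_class i; \<bar>k\<bar> < d i\<rbrakk> \<Longrightarrow> k \<in> diag ` C"
    and d_anti: "real (card {l \<in> anti_class (1 - i). \<bar>l - (int n - 1)\<bar> < int n - d i \<and> l \<notin> anti ` C}) \<le> 2 * B"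
    if "i \<in> {0, 1}" for i
    using gap[OF that] unfolding gap_def by auto
  define R where "R i = {c \<in> C - irregular. diag c \<in> diag_class i}" for i
  have R_C: "R i \<subseteq> C" and fin_R: "finite (R i)" for i
    unfolding R_def using finite_C by auto
  have diag_lt: "\<bar>diag c\<bar> < int n" and anti_lt: "\<bar>anti c - (int n - 1)\<bar> < int n" if "c \<in> C" for c
  proof -
    obtain x y where c: "c = (x, y)" by (cases c)
    then have "x < n" "y < n" using coords_lt[OF that] by auto
    then show "\<bar>diag c\<bar> < int n" "\<bar>anti c - (int n - 1)\<bar> < int n" unfolding c by auto
  qed
  have "card irregular * M \<le> 2 * B * M" using card_irregular M by (intro mult_right_mono) auto
  have diag_part: "(\<Sum>k | k \<in> diag_class i \<and> \<bar>k\<bar> < d i. gD i k)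
      \<le> (\<Sum>c\<in>R i. gD i (diag c)) + 2 * B * M" if i: "i \<in> {0, 1}" for i
  proof -
    let ?T = "{k. k \<in> diag_class i \<and> \<bar>k\<bar> < d i}"
    have "finite ?T" by (rule finite_subset[of _ "{- d i..d i}"]) auto
    moreover have "?T \<subseteq> diag ` R i \<union> diag ` irregular"
      using d_diag[OF i] unfolding R_def irregular_def by fastforce
    moreover have "gD i k \<le> M" if "k \<in> ?T" for k using that d[OF i] gD by auto
    moreover have "0 \<le> gD i (diag c)" if "c \<in> R i" for c using that R_C diag_lt gD by blast
    ultimately have "(\<Sum>k\<in>?T. gD i k) \<le> (\<Sum>c\<in>R i. gD i (diag c)) + M * card (diag ` irregular)"
      using fin_R finite_irregular M by (intro sum_le_sum_over_preimage) auto
    moreover have "M * card (diag ` irregular) \<le> M * card irregular"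
      using M finite_irregular by (intro mult_left_mono of_nat_mono card_image_le) auto
    ultimately show ?thesis using \<open>card irregular * M \<le> 2 * B * M\<close> by (simp add: mult.commute)
  qed
  have anti_part: "(\<Sum>l | l \<in> anti_class i \<and> \<bar>l - (int n - 1)\<bar> < int n - d (1 - i). gS i l)
      \<le> (\<Sum>c\<in>R i. gS i (anti c)) + 4 * B * M" if i: "i \<in> {0, 1}" for i
  proof -
    have i': "1 - i \<in> {0, 1}" using i by auto
    let ?T = "{l. l \<in> anti_class i \<and> \<bar>l - (int n - 1)\<bar> < int n - d (1 - i)}"
    define Z where "Z = {l \<in> anti_class i. \<bar>l - (int n - 1)\<bar> < int n - d (1 - i) \<and> l \<notin> anti ` C}"
    have cardZ: "real (card Z) \<le> 2 * B" using d_anti[OF i'] unfolding Z_def by simp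
    have fin: "finite ?T" by (rule finite_subset[of _ "{- int n..3 * int n}"]) (use d[OF i'] in auto)
    then have finZ: "finite Z" by (rule rev_finite_subset) (auto simp: Z_def)
    have cover: "?T \<subseteq> anti ` R i \<union> (anti ` irregular \<union> Z)"
    proof
      fix l assume l: "l \<in> ?T"
      show "l \<in> anti ` R i \<union> (anti ` irregular \<union> Z)"
      proof (cases "l \<in> anti ` C")
        case True
        then obtain c where c: "c \<in> C" "l = anti c" by blast
        show ?thesis
        proof (cases "c \<in> irregular")
          case False
          then have "c \<in> R i" using c l diag_class_iff_anti_class[of c i] unfolding R_def by auto
          then show ?thesis using c by blast
        qed (use c in blast)
      qed (use l Z_def in auto)
    qed
    have "gS i l \<le> M" if "l \<in> ?T" for l using that d[OF i'] gS by auto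
    moreover have "0 \<le> gS i (anti c)" if "c \<in> R i" for c using that R_C anti_lt gS by blast
    ultimately have "(\<Sum>l\<in>?T. gS i l) \<le> (\<Sum>c\<in>R i. gS i (anti c)) + M * card (anti ` irregular \<union> Z)"
      using fin fin_R finite_irregular finZ cover M by (intro sum_le_sum_over_preimage) auto
    moreover have "card (anti ` irregular \<union> Z) \<le> card irregular + card Z"
      using finite_irregular by (intro order_trans[OF card_Un_le] add_mono card_image_le) auto
    then have "M * card (anti ` irregular \<union> Z) \<le> M * (card irregular + card Z)"
      using M by (intro mult_left_mono) auto
    moreover have "M * card Z \<le> M * (2 * B)" using M cardZ by (intro mult_left_mono) auto
    ultimately show ?thesis using \<open>card irregular * M \<le> 2 * B * M\<close> by (simp add: algebra_simps)
  qed
  have class_part: "(\<Sum>c\<in>R i. gD i (diag c)) + (\<Sum>c\<in>R i. gS i (anti c)) \<le> (\<Sum>c\<in>R i. u (fst c) + v (snd c))"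
    if i: "i \<in> {0, 1}" for i
  proof -
    have "gD i (diag c) + gS i (anti c) \<le> u (fst c) + v (snd c)" if "c \<in> R i" for c
    proof -
      obtain x y where c: "c = (x, y)" by (cases c)
      then have "x < n" "y < n" using coords_lt[of c] that R_C by auto
      then show ?thesis using certificate[OF i] unfolding c by simp
    qed
    then show ?thesis unfolding sum.distrib[symmetric] by (rule sum_mono)
  qed
  have "k \<notin> diag_class 1" if "k \<in> diag_class 0" for k
  proof
    assume "k \<in> diag_class 1"
    then have "(int q - int p + 2) mod 4 = (int q - int p + 0) mod 4"
      using that unfolding diag_class_def by simp
    then show False by (simp only: mod_eq_dvd_iff) simp
  qed
  then have disj: "R 0 \<inter> R 1 = {}" unfolding R_def by auto
  have "(\<Sum>c\<in>R 0. u (fst c) + v (snd c)) + (\<Sum>c\<in>R 1. u (fst c) + v (snd c))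
      = (\<Sum>c\<in>R 0 \<union> R 1. u (fst c) + v (snd c))"
    using fin_R disj by (simp add: sum.union_disjoint)
  also have "\<dots> \<le> (\<Sum>c\<in>C. u (fst c) + v (snd c))"
    using R_C finite_C u v coords_lt by (intro sum_mono2) (auto intro!: add_nonneg_nonneg)
  also have "\<dots> = (\<Sum>c\<in>C. u (fst c)) + (\<Sum>c\<in>C. v (snd c))" by (rule sum.distrib)
  also have "\<dots> \<le> ((\<Sum>x | x < n \<and> x mod 2 = p. u x) + B * M) + ((\<Sum>y | y < n \<and> y mod 2 = q. v y) + B * M)"
    using column_excess(2)[of M u, OF M u] row_excess(2)[of M v, OF M v] by (intro add_mono) auto
  finally show ?thesis
    using diag_part[of 0] diag_part[of 1] anti_part[of 0] anti_part[of 1] class_part[of 0] class_part[of 1]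
    by (simp add: algebra_simps)
qed

lemma sum_lines:
  "(\<Sum>x | x < n \<and> x mod 2 = r. g (\<bar>real_of_int (2 * int x - (int n - 1))\<bar> / n))
    = (\<Sum>k | k mod 2 = int r mod 2 \<and> \<bar>2 * k - (int n - 1)\<bar> < int n. g (\<bar>real_of_int (2 * k - (int n - 1))\<bar> / n))"
  if "r < 2" for g :: "real \<Rightarrow> real"
proof -
  have "{k. k mod 2 = int r mod 2 \<and> \<bar>2 * k - (int n - 1)\<bar> < int n} = int ` {x. x < n \<and> x mod 2 = r}"
  proof (intro set_eqI iffI)
    fix k assume k: "k \<in> {k. k mod 2 = int r mod 2 \<and> \<bar>2 * k - (int n - 1)\<bar> < int n}"
    then have "0 \<le> k" "k < int n" by auto
    define x where "x = nat k"
    have x: "k = int x" "x < n" using \<open>0 \<le> k\<close> \<open>k < int n\<close> unfolding x_def by auto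
    then have "int (x mod 2) = int (r mod 2)" using k by (simp add: zmod_int)
    then have "x mod 2 = r" using that by simp
    then show "k \<in> int ` {x. x < n \<and> x mod 2 = r}" using x by blast
  next
    fix k assume "k \<in> int ` {x. x < n \<and> x mod 2 = r}"
    then obtain x where "k = int x" "x < n" "x mod 2 = r" by blast
    then show "k \<in> {k. k mod 2 = int r mod 2 \<and> \<bar>2 * k - (int n - 1)\<bar> < int n}"
      by (auto simp: zmod_int)
  qed
  then show ?thesis by (simp add: sum.reindex)
qed

text \<open>
  The continuous form of \<open>discrete_certificate\<close>: the sums are replaced by integrals with the help of
  \<open>residue_class_sum\<close>. Lines of one parity have density \<open>n/4\<close> on the scaled board and diagonals of one
  class have density \<open>n/8\<close>. The values \<open>w i\<close> do not depend on the certificate, so that several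
  certificates can be combined.
\<close>

lemma certificate_bound:
  fixes f F :: "real \<Rightarrow> real" and hD HD hS HS :: "int \<Rightarrow> real \<Rightarrow> real" and d :: "int \<Rightarrow> int"
  assumes f: "profile 1 f F M L"
    and hD: "\<And>i. profile 2 (hD i) (HD i) M L" and hS: "\<And>i. profile 2 (hS i) (HS i) M L"
    and cert: "\<And>i x y. \<lbrakk>i \<in> {0, 1}; \<bar>x\<bar> \<le> 1; \<bar>y\<bar> \<le> 1\<rbrakk> \<Longrightarrow> hD i \<bar>y - x\<bar> + hS i \<bar>x + y\<bar> \<le> f \<bar>x\<bar> + f \<bar>y\<bar>"
    and gap: "\<And>i. i \<in> {0, 1} \<Longrightarrow> gap i (d i)" and n: "80 \<le> n"
  defines "w \<equiv> \<lambda>i. 2 * real_of_int (d i) / n"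
  shows "HD 0 (w 0) + HD 1 (w 1) + HS 0 (2 - w 1) + HS 1 (2 - w 0) - 4 * F 1
    \<le> 4 / n * (14 * B * M + 14 * M + 13 * L)"
proof -
  define a where "a = int n - 1"
  define U where "U k = f (\<bar>real_of_int (2 * k - a)\<bar> / n)" for k
  define gD where "gD i k = hD i (\<bar>real_of_int (2 * k - 0)\<bar> / n)" for i k
  define gS where "gS i l = hS i (\<bar>real_of_int (2 * l - 2 * a)\<bar> / n)" for i l
  have n0: "0 < real n" using n by simp
  have L0: "0 \<le> L" using profile_L_nonneg[OF f] .
  have M0: "0 \<le> M" using profile_M_nonneg[OF f] .
  have le: "t / n \<le> s \<longleftrightarrow> t \<le> s * n" for s t :: real using n0 by (simp add: field_simps)
  have U: "0 \<le> U (int x) \<and> U (int x) \<le> M" if "x < n" for x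
    unfolding U_def a_def using that by (intro profile_bounds[OF f]) (auto simp: le)
  have gD: "0 \<le> gD i k \<and> gD i k \<le> M" if "\<bar>k\<bar> < int n" for i k
    unfolding gD_def using that by (intro profile_bounds[OF hD]) (auto simp: le)
  have gS: "0 \<le> gS i l \<and> gS i l \<le> M" if "\<bar>l - (int n - 1)\<bar> < int n" for i l
    unfolding gS_def a_def using that by (intro profile_bounds[OF hS]) (auto simp: le)
  have cert': "gD i (int y - int x) + gS i (int x + int y) \<le> U (int x) + U (int y)"
    if "i \<in> {0, 1}" "x < n" "y < n" for i x y
  proof -
    define X where "X = real_of_int (2 * int x - a) / n"
    define Y where "Y = real_of_int (2 * int y - a) / n"
    have abs: "\<bar>real_of_int z\<bar> / n = \<bar>real_of_int z / n\<bar>" for z by simp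
    have XY: "\<bar>X\<bar> \<le> 1" "\<bar>Y\<bar> \<le> 1" using that unfolding X_def Y_def a_def by auto
    have "real_of_int (2 * (int y - int x) - 0) / n = Y - X"
      unfolding X_def Y_def by (simp add: diff_divide_distrib)
    moreover have "real_of_int (2 * (int x + int y) - 2 * a) / n = X + Y"
      unfolding X_def Y_def by (simp add: diff_divide_distrib add_divide_distrib)
    ultimately show ?thesis using cert[OF that(1) XY] unfolding gD_def gS_def U_def abs X_def Y_def by simp
  qed
  have dr: "0 \<le> d i \<and> d i \<le> int n" if "i \<in> {0, 1}" for i using gap[OF that] unfolding gap_def by auto
  have disc: "(\<Sum>i\<in>{0, 1}. (\<Sum>k | k \<in> diag_class i \<and> \<bar>k\<bar> < d i. gD i k)
      + (\<Sum>l | l \<in> anti_class i \<and> \<bar>l - (int n - 1)\<bar> < int n - d (1 - i). gS i l))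
    \<le> (\<Sum>x | x < n \<and> x mod 2 = p. U (int x)) + (\<Sum>y | y < n \<and> y mod 2 = q. U (int y)) + 14 * B * M"
    using M0 U gD gS cert' gap by (intro discrete_certificate[where d = d]) blast+
  have lines: "(\<Sum>x | x < n \<and> x mod 2 = r. U (int x)) \<le> n / 2 * F 1 + 3 * M + 2 * (L * (1 + 4 / n))" if "r < 2" for r
    using residue_class_sum(3)[OF f, where m = 2 and n = n and b = "int n" and r = "int r" and a = a] n0 n that
    unfolding U_def a_def by (subst sum_lines) simp_all
  have diags: "(\<Sum>k | k \<in> diag_class i \<and> \<bar>k\<bar> < d i. gD i k)
      \<ge> n / 4 * HD i (w i) - 2 * M - 2 * (L * (w i + 8 / n))" if "i \<in> {0, 1}" for i
  proof -
    have "{k. k \<in> diag_class i \<and> \<bar>k\<bar> < d i}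
        = {k. k mod 4 = (int q - int p + 2 * i) mod 4 \<and> \<bar>2 * k - 0\<bar> < 2 * d i}"
      unfolding diag_class_def by auto
    then show ?thesis
      using residue_class_sum(2)[OF hD[of i], where m = 4 and n = n and b = "2 * d i" and r = "int q - int p + 2 * i" and a = 0] n0 dr[OF that]
      unfolding gD_def w_def by simp
  qed
  have antis: "(\<Sum>l | l \<in> anti_class i \<and> \<bar>l - (int n - 1)\<bar> < int n - d (1 - i). gS i l)
      \<ge> n / 4 * HS i (2 - w (1 - i)) - 2 * M - 2 * (L * (2 - w (1 - i) + 8 / n))" if "i \<in> {0, 1}" for i
  proof -
    have i': "1 - i \<in> {0, 1}" using that by auto
    have "{l. l \<in> anti_class i \<and> \<bar>l - (int n - 1)\<bar> < int n - d (1 - i)}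
        = {l. l mod 4 = (int p + int q + 2 * i) mod 4 \<and> \<bar>2 * l - 2 * a\<bar> < 2 * (int n - d (1 - i))}"
      unfolding anti_class_def a_def by auto
    moreover have "real_of_int (2 * (int n - d (1 - i))) / n = 2 - w (1 - i)"
      unfolding w_def using n0 by (simp add: field_simps)
    ultimately show ?thesis
      using residue_class_sum(2)[OF hS[of i], where m = 4 and n = n and b = "2 * (int n - d (1 - i))" and r = "int p + int q + 2 * i" and a = "2 * a"] n0 dr[OF i']
      unfolding gS_def by simp
  qed
  \<comment> \<open>The interval lengths add up to 4 for the diagonals and 2 for the lines, hence the Lipschitz error is \<open>12 L\<close> plus this term.\<close>
  have "L * (80 / n) \<le> L * 1" using n L0 by (intro mult_left_mono) auto
  then have "n / 4 * (HD 0 (w 0) + HD 1 (w 1) + HS 0 (2 - w 1) + HS 1 (2 - w 0) - 4 * F 1)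
      \<le> 14 * B * M + 14 * M + 13 * L"
    using disc lines[OF p_lt] lines[OF q_lt] diags[of 0] diags[of 1] antis[of 0] antis[of 1]
    by (simp add: algebra_simps)
  then have "4 / n * (n / 4 * (HD 0 (w 0) + HD 1 (w 1) + HS 0 (2 - w 1) + HS 1 (2 - w 0) - 4 * F 1))
      \<le> 4 / n * (14 * B * M + 14 * M + 13 * L)"
    using n0 by (intro mult_left_mono) auto
  moreover have "4 / n * (n / 4 * z) = z" for z using n0 by simp
  ultimately show ?thesis by metis
qed

end

section \<open>A piecewise quadratic certificate\<close>

definition ramp :: "real \<Rightarrow> real" where "ramp x = max 0 x"

text \<open>
  Piecewise quadratic functions are written as quadratic splines in \<open>ramp\<close>, because their
  antiderivatives are then given by a single formula that is differentiable also at the knots.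
\<close>

lemma DERIV_ramp_power:
  "((\<lambda>x. ramp (x - k) ^ Suc (Suc j)) has_real_derivative real (j + 2) * ramp (x - k) ^ Suc j) (at x)"
proof (cases "x = k")
  case False
  show ?thesis
  proof (cases "x < k")
    case True
    have "((\<lambda>x. 0) has_real_derivative real (j + 2) * ramp (x - k) ^ Suc j) (at x)"
      using True by (simp add: ramp_def)
    then show ?thesis
      by (rule has_field_derivative_transform_within_open[where S = "{..<k}"]) (use True in \<open>auto simp: ramp_def\<close>)
  next
    case False
    then have "k < x" using \<open>x \<noteq> k\<close> by simp
    have "((\<lambda>x. (x - k) ^ Suc (Suc j)) has_real_derivative real (j + 2) * (x - k) ^ Suc j) (at x)"
      by (auto intro!: derivative_eq_intros simp del: power_Suc)
    then have "((\<lambda>x. (x - k) ^ Suc (Suc j)) has_real_derivative real (j + 2) * ramp (x - k) ^ Suc j) (at x)"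
      using \<open>k < x\<close> by (simp add: ramp_def)
    then show ?thesis
      by (rule has_field_derivative_transform_within_open[where S = "{k<..}"]) (use \<open>k < x\<close> in \<open>auto simp: ramp_def\<close>)
  qed
next
  case True
  have "(\<lambda>h. (ramp (k + h - k) ^ Suc (Suc j) - ramp (k - k) ^ Suc (Suc j)) / h) \<midarrow>0\<rightarrow> 0"
  proof (rule LIM_I)
    fix r :: real assume "0 < r"
    have "\<bar>ramp h ^ Suc (Suc j) / h\<bar> < r" if "h \<noteq> 0" "\<bar>h\<bar> < min r 1" for h
    proof (cases "0 < h")
      case True
      have "h * h ^ j \<le> h * 1" using True that by (intro mult_left_mono power_le_one) auto
      then have "h * h ^ j < r" using that by linarith
      then show ?thesis using True by (simp add: ramp_def)
    qed (use that \<open>0 < r\<close> in \<open>simp add: ramp_def\<close>)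
    then show "\<exists>s>0. \<forall>h. h \<noteq> 0 \<and> norm (h - 0) < s \<longrightarrow>
        norm ((ramp (k + h - k) ^ Suc (Suc j) - ramp (k - k) ^ Suc (Suc j)) / h - 0) < r"
      using \<open>0 < r\<close> by (intro exI[of _ "min r 1"]) (auto simp: ramp_def)
  qed
  then show ?thesis using True by (simp add: DERIV_def ramp_def)
qed

lemma DERIV_ramp_square [derivative_intros]:
  "((\<lambda>x. ramp (x - k) ^ 2) has_real_derivative 2 * ramp (x - k)) (at x)"
  using DERIV_ramp_power[of k 0 x] by (simp add: numeral_2_eq_2)

lemma DERIV_ramp_cube [derivative_intros]:
  "((\<lambda>x. ramp (x - k) ^ 3) has_real_derivative 3 * ramp (x - k) ^ 2) (at x)"
  using DERIV_ramp_power[of k 1 x] by (simp add: numeral_3_eq_3 numeral_2_eq_2)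

definition lipschitz_between :: "real \<Rightarrow> real \<Rightarrow> real \<Rightarrow> (real \<Rightarrow> real) \<Rightarrow> bool" where
  "lipschitz_between L a b g \<longleftrightarrow> (\<forall>s t. a \<le> s \<and> s \<le> t \<and> t \<le> b \<longrightarrow> \<bar>g s - g t\<bar> \<le> L * (t - s))"

lemma lipschitz_between_glue: "lipschitz_between L a b g \<Longrightarrow> lipschitz_between L b c g \<Longrightarrow> lipschitz_between L a c g"
  unfolding lipschitz_between_def
proof (intro allI impI)
  fix s t
  assume 1: "\<forall>s t. a \<le> s \<and> s \<le> t \<and> t \<le> b \<longrightarrow> \<bar>g s - g t\<bar> \<le> L * (t - s)"
    and 2: "\<forall>s t. b \<le> s \<and> s \<le> t \<and> t \<le> c \<longrightarrow> \<bar>g s - g t\<bar> \<le> L * (t - s)"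
    and st: "a \<le> s \<and> s \<le> t \<and> t \<le> c"
  consider "t \<le> b" | "b \<le> s" | "s \<le> b" "b \<le> t" by linarith
  then show "\<bar>g s - g t\<bar> \<le> L * (t - s)"
  proof cases
    case 3
    then have "\<bar>g s - g b\<bar> \<le> L * (b - s)" "\<bar>g b - g t\<bar> \<le> L * (t - b)" using 1 2 st by auto
    then show ?thesis by (simp add: algebra_simps)
  qed (use 1 2 st in auto)
qed

lemma lipschitz_between_quadratic:
  assumes "\<And>t. a \<le> t \<Longrightarrow> t \<le> b \<Longrightarrow> g t = \<alpha> + \<beta> * t + \<gamma> * t\<^sup>2"
    and "\<bar>\<beta> + 2 * \<gamma> * a\<bar> \<le> L" "\<bar>\<beta> + 2 * \<gamma> * b\<bar> \<le> L"
  shows "lipschitz_between L a b g"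
  unfolding lipschitz_between_def
proof (intro allI impI)
  fix s t assume st: "a \<le> s \<and> s \<le> t \<and> t \<le> b"
  have "g s - g t = (s - t) * (\<beta> + \<gamma> * (s + t))"
    using assms(1)[of s] assms(1)[of t] st by (simp add: algebra_simps power2_eq_square)
  moreover have "\<bar>\<beta> + \<gamma> * (s + t)\<bar> \<le> L"
  proof (cases "0 \<le> \<gamma>")
    case True
    then have "\<gamma> * (2 * a) \<le> \<gamma> * (s + t)" "\<gamma> * (s + t) \<le> \<gamma> * (2 * b)"
      using st by (auto intro!: mult_left_mono)
    then show ?thesis using assms(2,3) by (simp add: abs_le_iff algebra_simps)
  next
    case False
    then have "\<gamma> * (s + t) \<le> \<gamma> * (2 * a)" "\<gamma> * (2 * b) \<le> \<gamma> * (s + t)"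
      using st by (auto intro!: mult_left_mono_neg)
    then show ?thesis using assms(2,3) by (simp add: abs_le_iff algebra_simps)
  qed
  then have "\<bar>s - t\<bar> * \<bar>\<beta> + \<gamma> * (s + t)\<bar> \<le> \<bar>s - t\<bar> * L" by (intro mult_left_mono) auto
  moreover have "\<bar>s - t\<bar> = t - s" using st by simp
  ultimately show "\<bar>g s - g t\<bar> \<le> L * (t - s)" by (simp add: abs_mult mult.commute)
qed

lemma profileI:
  assumes "0 < \<tau>" "\<Phi> 0 = 0" "\<And>t. (\<Phi> has_real_derivative \<phi> t) (at t)"
    and "\<And>t. 0 \<le> t \<Longrightarrow> t \<le> \<tau> \<Longrightarrow> 0 \<le> \<phi> t \<and> \<phi> t \<le> M" "lipschitz_between L 0 \<tau> \<phi>"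
  shows "profile \<tau> \<phi> \<Phi> M L"
proof -
  have "\<bar>\<phi> s - \<phi> t\<bar> \<le> L * \<bar>s - t\<bar>" if "s \<in> {0..\<tau>}" "t \<in> {0..\<tau>}" for s t
  proof (cases "s \<le> t")
    case True
    then show ?thesis using assms(5)[unfolded lipschitz_between_def, rule_format, of s t] that by simp
  next
    case False
    then show ?thesis using assms(5)[unfolded lipschitz_between_def, rule_format, of t s] that by (simp add: abs_minus_commute)
  qed
  then show ?thesis using assms unfolding profile_def by auto
qed

lemma profile_const: "0 \<le> c \<Longrightarrow> c \<le> M \<Longrightarrow> 0 < \<tau> \<Longrightarrow> profile \<tau> (\<lambda>_. c) (\<lambda>t. c * t) M 0"
  unfolding profile_def by (auto intro!: derivative_eq_intros)

lemma profile_quadratic: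
  assumes "0 < \<tau>" "0 \<le> a" "a \<le> M" "0 \<le> a + b * \<tau>\<^sup>2" "a + b * \<tau>\<^sup>2 \<le> M" "\<bar>2 * b * \<tau>\<bar> \<le> L"
  shows "profile \<tau> (\<lambda>t. a + b * t\<^sup>2) (\<lambda>t. a * t + b * t ^ 3 / 3) M L"
proof (rule profileI)
  fix t show "((\<lambda>t. a * t + b * t ^ 3 / 3) has_real_derivative a + b * t\<^sup>2) (at t)"
    by (auto intro!: derivative_eq_intros)
  assume t: "0 \<le> t" "t \<le> \<tau>"
  then have t2: "0 \<le> t\<^sup>2" "t\<^sup>2 \<le> \<tau>\<^sup>2" by (auto intro: power_mono)
  show "0 \<le> a + b * t\<^sup>2 \<and> a + b * t\<^sup>2 \<le> M"
  proof (cases "0 \<le> b")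
    case True
    then have "0 \<le> b * t\<^sup>2" "b * t\<^sup>2 \<le> b * \<tau>\<^sup>2" using t2 by (auto intro: mult_left_mono)
    then show ?thesis using assms by linarith
  next
    case False
    then have "b * t\<^sup>2 \<le> 0" "b * \<tau>\<^sup>2 \<le> b * t\<^sup>2" using t2 by (auto intro: mult_left_mono_neg simp: mult_nonpos_nonneg)
    then show ?thesis using assms by linarith
  qed
next
  show "lipschitz_between L 0 \<tau> (\<lambda>t. a + b * t\<^sup>2)"
    by (rule lipschitz_between_quadratic[where \<alpha> = a and \<beta> = 0 and \<gamma> = b]) (use assms in auto)
qed (use assms in auto)

text \<open>
  The certificate consists of a weight for lines, a weight for the diagonals of the class that stays
  near the centre (\<open>w \<approx> 1 - 1/\<surd>3\<close>), and a weight for those of the other class. In the coordinates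
  \<open>u = x + y\<close> and \<open>v = x - y\<close> with \<open>0 \<le> y \<le> x\<close> it is assembled from three identities between quadratic
  functions, each the parallelogram law in disguise. Put \<open>\<gamma> = -27/250\<close> and \<open>\<theta> = 1027/2000\<close>.

  \<^item> \<open>(\<gamma> - 7/3 x\<^sup>2) + (\<gamma> - 7/3 y\<^sup>2) = (\<gamma> - 7/6 u\<^sup>2) + (\<gamma> - 7/6 v\<^sup>2)\<close>

  \<^item> \<open>(x\<^sup>2 - 13/10 x) + (y\<^sup>2 - 13/10 y) = (u\<^sup>2/2 - 13/10 u + \<theta>) + (v\<^sup>2/2 - \<theta>)\<close>

  \<^item> \<open>(2\<kappa> - \<gamma> - 7/3 (x - 17/20)\<^sup>2) + (\<gamma> - 7/3 y\<^sup>2) = (\<kappa> - 7/6 (u - 17/20)\<^sup>2) + (\<kappa> - 7/6 (v - 17/20)\<^sup>2)\<close>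
    with \<open>\<kappa> = -201/800\<close>

  Up to the common shift \<open>3/4\<close>, which makes all weights nonnegative, \<open>line_wt\<close> is the concave quadratic
  of the first identity up to \<open>27/100\<close> and the convex one of the second identity from there on.
  The weight \<open>outer_wt\<close> is \<open>t\<^sup>2/2 - \<theta>\<close> up to \<open>67/100\<close>, then the cap \<open>\<kappa> - 7/6 (t - 17/20)\<^sup>2\<close>, and from
  \<open>91/100\<close> on \<open>t\<^sup>2/2 - 13/10 t + \<theta>\<close>. The weight \<open>inner_wt\<close> is made constant beyond \<open>37/50\<close>, outside the
  range in which its integral is needed, to keep it from becoming negative. For the given
  curvatures the constants nearly maximise the gain in \<open>certificate_gain\<close> at \<open>w = 1 - 1/\<surd>3\<close>, and the
  curvature \<open>7/3\<close> makes it nearly stationary there.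
\<close>

definition line_wt where "line_wt t = 3/4 - 27/250 - 7/3 * t\<^sup>2 + 1/2 * ramp (t - 27/100) + 10/3 * ramp (t - 27/100) ^ 2"
definition line_int where "line_int t = (3/4 - 27/250) * t - 7/9 * t ^ 3 + 1/4 * ramp (t - 27/100) ^ 2 + 10/9 * ramp (t - 27/100) ^ 3"
definition inner_wt where "inner_wt t = 3/4 - 27/250 - 7/6 * t\<^sup>2 + 259/150 * ramp (t - 37/50) + 7/6 * ramp (t - 37/50) ^ 2"
definition inner_int where "inner_int t = (3/4 - 27/250) * t - 7/18 * t ^ 3 + 259/300 * ramp (t - 37/50) ^ 2 + 7/18 * ramp (t - 37/50) ^ 3"
definition outer_wt where "outer_wt t = 3/4 - 1027/2000 + t\<^sup>2 / 2 - 1/4 * ramp (t - 67/100) - 5/3 * ramp (t - 67/100) ^ 2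
   - 1/4 * ramp (t - 91/100) + 5/3 * ramp (t - 91/100) ^ 2"
definition outer_int where "outer_int t = (3/4 - 1027/2000) * t + t ^ 3 / 6 - 1/8 * ramp (t - 67/100) ^ 2 - 5/9 * ramp (t - 67/100) ^ 3
   - 1/8 * ramp (t - 91/100) ^ 2 + 5/9 * ramp (t - 91/100) ^ 3"

lemma line_wt_low: "t \<le> 27/100 \<Longrightarrow> line_wt t = 3/4 - 27/250 - 7/3 * t\<^sup>2"
  and line_wt_high: "27/100 \<le> t \<Longrightarrow> line_wt t = 3/4 - 13/10 * t + t\<^sup>2"
  unfolding line_wt_def ramp_def by (simp_all add: power2_eq_square field_simps max_def)
lemma inner_wt_low: "t \<le> 37/50 \<Longrightarrow> inner_wt t = 3/4 - 27/250 - 7/6 * t\<^sup>2"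
  and inner_wt_high: "37/50 \<le> t \<Longrightarrow> inner_wt t = 3/4 - 27/250 - 7/6 * (37/50)\<^sup>2"
  unfolding inner_wt_def ramp_def by (simp_all add: power2_eq_square field_simps max_def)
lemma outer_wt_low: "t \<le> 67/100 \<Longrightarrow> outer_wt t = 3/4 - 1027/2000 + t\<^sup>2 / 2"
  and outer_wt_mid: "67/100 \<le> t \<Longrightarrow> t \<le> 91/100 \<Longrightarrow> outer_wt t = 3/4 - 201/800 - 7/6 * (t - 17/20)\<^sup>2"
  and outer_wt_high: "91/100 \<le> t \<Longrightarrow> outer_wt t = 3/4 + 1027/2000 - 13/10 * t + t\<^sup>2 / 2"
  unfolding outer_wt_def ramp_def by (simp_all add: power2_eq_square field_simps max_def)

lemma line_ge_cap: "line_wt t \<ge> 3/4 - 27/250 - 7/3 * t\<^sup>2"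
  unfolding line_wt_def by (simp add: ramp_def)

text \<open>
  The two quadratic pieces of \<open>line_wt\<close> cross at \<open>12/100\<close> and \<open>27/100\<close>; between these points the concave
  one is larger.
\<close>

lemma line_ge_parabola:
  assumes "12/100 \<le> t"
  shows "line_wt t \<ge> 3/4 - 13/10 * t + t\<^sup>2"
proof (cases "t \<le> 27/100")
  case True
  then have "(t - 12/100) * (27/100 - t) \<ge> 0" using assms by (intro mult_nonneg_nonneg) auto
  then show ?thesis unfolding line_wt_low[OF True] by (simp add: power2_eq_square field_simps)
qed (simp add: line_wt_high)

lemma line_ge_min: assumes "0 \<le> t" shows "line_wt t \<ge> 3/4 - 169/400"
proof (cases "t \<le> 27/100")
  case True
  then have "t * t \<le> 27/100 * (27/100)" using assms by (intro mult_mono) auto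
  then show ?thesis unfolding line_wt_low[OF True] by (simp add: power2_eq_square field_simps)
next
  case False
  have "0 \<le> (t - 13/20)\<^sup>2" by simp
  then show ?thesis using False by (simp add: line_wt_high power2_eq_square field_simps)
qed

lemma outer_le_central: "outer_wt t \<le> 3/4 - 1027/2000 + t\<^sup>2 / 2"
proof -
  consider "t \<le> 67/100" | "67/100 \<le> t" "t \<le> 91/100" | "91/100 \<le> t" by linarith
  then show ?thesis
  proof cases
    case 2
    have "0 \<le> (t - 67/100) * (t - 52/100)" using 2 by (intro mult_nonneg_nonneg) auto
    then show ?thesis using 2 by (simp add: outer_wt_mid power2_eq_square field_simps)
  qed (simp_all add: outer_wt_low outer_wt_high)
qed

lemma outer_le_peripheral: "outer_wt t \<le> 3/4 + 1027/2000 - 13/10 * t + t\<^sup>2 / 2"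
proof -
  consider "t \<le> 67/100" | "67/100 \<le> t" "t \<le> 91/100" | "91/100 \<le> t" by linarith
  then show ?thesis
  proof cases
    case 2
    have "0 \<le> (91/100 - t) * (106/100 - t)" using 2 by (intro mult_nonneg_nonneg) auto
    then show ?thesis using 2 by (simp add: outer_wt_mid power2_eq_square field_simps)
  qed (simp_all add: outer_wt_low outer_wt_high)
qed

text \<open>
  Besides the knots \<open>67/100\<close> and \<open>91/100\<close>, the cap meets the neighbouring quadratic pieces once more at
  \<open>52/100\<close> and \<open>106/100\<close>. Between these points it dominates them outside the knots.
\<close>

lemma outer_le_cap: assumes "52/100 \<le> t" "t \<le> 106/100" shows "outer_wt t \<le> 3/4 - 201/800 - 7/6 * (t - 17/20)\<^sup>2"
proof -
  consider "t \<le> 67/100" | "67/100 \<le> t" "t \<le> 91/100" | "91/100 \<le> t" by linarith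
  then show ?thesis
  proof cases
    case 1
    have "0 \<le> (67/100 - t) * (t - 52/100)" using 1 assms by (intro mult_nonneg_nonneg) auto
    then show ?thesis using 1 by (simp add: outer_wt_low power2_eq_square field_simps)
  next
    case 3
    have "0 \<le> (t - 91/100) * (106/100 - t)" using 3 assms by (intro mult_nonneg_nonneg) auto
    then show ?thesis using 3 by (simp add: outer_wt_high power2_eq_square field_simps)
  qed (simp add: outer_wt_mid)
qed

text \<open>
  If \<open>x + y\<close> is below the knot, this is the first identity. Otherwise the constant value of \<open>inner_wt\<close>
  is so small that the minimum of \<open>line_wt\<close> suffices.
\<close>

lemma inner_certificate:
  assumes "0 \<le> y" "y \<le> x"
  shows "inner_wt (x - y) + inner_wt (x + y) \<le> line_wt x + line_wt y"
proof (cases "x + y \<le> 37/50")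
  case True
  then have "inner_wt (x - y) = 3/4 - 27/250 - 7/6 * (x - y)\<^sup>2" "inner_wt (x + y) = 3/4 - 27/250 - 7/6 * (x + y)\<^sup>2"
    using assms inner_wt_low[of "x - y"] inner_wt_low[of "x + y"] by simp_all
  moreover have "(x - y)\<^sup>2 + (x + y)\<^sup>2 = 2 * x\<^sup>2 + 2 * y\<^sup>2" by (simp add: power2_eq_square algebra_simps)
  ultimately show ?thesis using line_ge_cap[of x] line_ge_cap[of y] assms by linarith
next
  case False
  have "inner_wt (x - y) \<le> 3/4 - 27/250"
    by (cases "x - y \<le> 37/50") (simp_all add: inner_wt_low inner_wt_high)
  moreover have "inner_wt (x + y) = 3/4 - 27/250 - 7/6 * (37/50)\<^sup>2" using False by (simp add: inner_wt_high)
  ultimately show ?thesis using line_ge_min[of x] line_ge_min[of y] assms by (simp add: power2_eq_square)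
qed

text \<open>
  For \<open>y \<ge> 12/100\<close> the second identity applies. For smaller \<open>y\<close> the value of \<open>line_wt y\<close> lies below
  the parabola of that identity, and the bound needed for \<open>outer_wt (x \<plusminus> y)\<close> depends on \<open>x\<close>: the quadratic
  before the cap twice, the cap twice (the third identity), or the quadratic after the cap twice. These cases meet exactly
  at the knots \<open>67/100\<close> and \<open>91/100\<close>. For the cap one needs \<open>x\<^sup>2 - 13/10 x\<close> to be at least
  \<open>2\<kappa> - \<gamma> - 7/3 (x - 17/20)\<^sup>2\<close>; the difference is \<open>10/3 (x - 79/100)\<^sup>2\<close>.
\<close>

lemma outer_certificate:
  assumes y: "0 \<le> y" and yx: "y \<le> x"
  shows "outer_wt (x - y) + outer_wt (x + y) \<le> line_wt x + line_wt y"
proof -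
  have sq: "(x - y)\<^sup>2 = x\<^sup>2 - 2 * (x * y) + y\<^sup>2" "(x + y)\<^sup>2 = x\<^sup>2 + 2 * (x * y) + y\<^sup>2"
    by (simp_all add: power2_eq_square algebra_simps)
  note inner = outer_le_central[of "x - y", unfolded sq] outer_le_central[of "x + y", unfolded sq]
  note outer = outer_le_peripheral[of "x - y", unfolded sq] outer_le_peripheral[of "x + y", unfolded sq]
  show ?thesis
  proof (cases "12/100 \<le> y")
    case True
    show ?thesis
      using line_ge_parabola[OF order_trans[OF True yx]] line_ge_parabola[OF True] inner(1) outer(2)
      by (simp add: field_simps)
  next
    case False
    then have fy: "line_wt y = 3/4 - 27/250 - 7/3 * y\<^sup>2" by (simp add: line_wt_low)
    have y2: "y\<^sup>2 \<le> 144/10000" using y False power_mono[of y "12/100" 2] by (simp add: power2_eq_square)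
    consider "x \<le> 12/100" | "12/100 \<le> x" "x \<le> 67/100" | "67/100 \<le> x" "x \<le> 91/100" | "91/100 \<le> x"
      by linarith
    then show ?thesis
    proof cases
      case 1
      then have x2: "x\<^sup>2 \<le> 144/10000"
        using y yx power_mono[of x "12/100" 2] by (simp add: power2_eq_square)
      have fx: "line_wt x = 3/4 - 27/250 - 7/3 * x\<^sup>2" using 1 by (simp add: line_wt_low)
      show ?thesis using fx fy x2 y2 inner by (simp add: field_simps)
    next
      case 2
      then show ?thesis using fy y2 line_ge_parabola[OF 2(1)] inner by (simp add: field_simps)
    next
      case 3
      have "0 \<le> (x - 79/100)\<^sup>2" by simp
      also have "(x - 79/100)\<^sup>2 = x\<^sup>2 - 79/50 * x + (79/100)\<^sup>2"
        by (simp add: power2_eq_square field_simps)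
      finally have gap: "0 \<le> x\<^sup>2 - 79/50 * x + (79/100)\<^sup>2" .
      have sq': "(x - y - 17/20)\<^sup>2 = x\<^sup>2 - 2 * (x * y) + y\<^sup>2 - 17/10 * (x - y) + 289/400"
        "(x + y - 17/20)\<^sup>2 = x\<^sup>2 + 2 * (x * y) + y\<^sup>2 - 17/10 * (x + y) + 289/400"
        by (simp_all add: power2_eq_square field_simps)
      have "outer_wt (x - y) \<le> 3/4 - 201/800 - 7/6 * (x - y - 17/20)\<^sup>2"
        "outer_wt (x + y) \<le> 3/4 - 201/800 - 7/6 * (x + y - 17/20)\<^sup>2"
        using 3 False y outer_le_cap[of "x - y"] outer_le_cap[of "x + y"] by simp_all
      note cap = this[unfolded sq']
      show ?thesis using 3 gap cap fy line_ge_parabola[of x] by (simp add: field_simps)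
    next
      case 4
      then show ?thesis using fy y2 line_ge_parabola[of x] outer by (simp add: field_simps)
    qed
  qed
qed

lemma even_certificate:
  fixes g h :: "real \<Rightarrow> real"
  assumes "\<And>x y. \<lbrakk>0 \<le> y; y \<le> x\<rbrakk> \<Longrightarrow> h (x - y) + h (x + y) \<le> g x + g y"
  shows "h \<bar>y - x\<bar> + h \<bar>x + y\<bar> \<le> g \<bar>x\<bar> + g \<bar>y\<bar>"
proof -
  have 1: "h (\<bar>\<bar>x\<bar> - \<bar>y\<bar>\<bar>) + h (\<bar>x\<bar> + \<bar>y\<bar>) \<le> g \<bar>x\<bar> + g \<bar>y\<bar>"
    using assms[of "\<bar>y\<bar>" "\<bar>x\<bar>"] assms[of "\<bar>x\<bar>" "\<bar>y\<bar>"]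
    by (cases "\<bar>y\<bar> \<le> \<bar>x\<bar>") (auto simp: add.commute)
  have "\<bar>y - x\<bar> = \<bar>\<bar>x\<bar> - \<bar>y\<bar>\<bar> \<and> \<bar>x + y\<bar> = \<bar>x\<bar> + \<bar>y\<bar> \<or> \<bar>y - x\<bar> = \<bar>x\<bar> + \<bar>y\<bar> \<and> \<bar>x + y\<bar> = \<bar>\<bar>x\<bar> - \<bar>y\<bar>\<bar>"
    by linarith
  then show ?thesis using 1 by (auto simp: add.commute)
qed

lemma profile_line: "profile 1 line_wt line_int (2/3) (7/4)"
proof (rule profileI)
  fix t
  show "(line_int has_real_derivative line_wt t) (at t)"
    unfolding line_int_def line_wt_def by (rule derivative_eq_intros refl | simp)+
  assume t: "0 \<le> t" "t \<le> 1"
  show "0 \<le> line_wt t \<and> line_wt t \<le> 2/3"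
  proof
    show "0 \<le> line_wt t" using line_ge_min[of t] t by simp
    show "line_wt t \<le> 2/3"
    proof (cases "t \<le> 27/100")
      case False
      have "0 \<le> (1 - t) * (t - 27/100)" using t False by (intro mult_nonneg_nonneg) auto
      moreover have "(1 - t) * (t - 27/100) = 127/100 * t - 27/100 - t\<^sup>2"
        by (simp add: power2_eq_square field_simps)
      ultimately have "t\<^sup>2 \<le> 127/100 * t - 27/100" by linarith
      then show ?thesis using False by (simp add: line_wt_high)
    next
      case True
      show ?thesis unfolding line_wt_low[OF True] using zero_le_power2[of t] by linarith
    qed
  qed
next
  have "lipschitz_between (7/4) 0 (27/100) line_wt"
    by (rule lipschitz_between_quadratic[where \<alpha> = "3/4 - 27/250" and \<beta> = 0 and \<gamma> = "-7/3"]) (auto simp: line_wt_low)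
  moreover have "lipschitz_between (7/4) (27/100) 1 line_wt"
    by (rule lipschitz_between_quadratic[where \<alpha> = "3/4" and \<beta> = "-13/10" and \<gamma> = "1"]) (auto simp: line_wt_high)
  ultimately show "lipschitz_between (7/4) 0 1 line_wt" by (rule lipschitz_between_glue)
qed (auto simp: line_int_def ramp_def)

lemma profile_inner: "profile 2 inner_wt inner_int (2/3) (7/4)"
proof (rule profileI)
  fix t
  show "(inner_int has_real_derivative inner_wt t) (at t)"
    unfolding inner_int_def inner_wt_def by (rule derivative_eq_intros refl | simp)+
  assume t: "0 \<le> t" "t \<le> 2"
  show "0 \<le> inner_wt t \<and> inner_wt t \<le> 2/3"
  proof (cases "t \<le> 37/50")
    case True
    then have "t * t \<le> 37/50 * (37/50)" using t by (intro mult_mono) auto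
    moreover have "0 \<le> t * t" by simp
    ultimately show ?thesis unfolding inner_wt_low[OF True] power2_eq_square by linarith
  qed (simp add: inner_wt_high power2_eq_square)
next
  have "lipschitz_between (7/4) 0 (37/50) inner_wt"
    by (rule lipschitz_between_quadratic[where \<alpha> = "3/4 - 27/250" and \<beta> = 0 and \<gamma> = "-7/6"]) (auto simp: inner_wt_low)
  moreover have "lipschitz_between (7/4) (37/50) 2 inner_wt"
    by (rule lipschitz_between_quadratic[where \<alpha> = "3/4 - 27/250 - 7/6 * (37/50)\<^sup>2" and \<beta> = "0" and \<gamma> = "0"]) (auto simp: inner_wt_high)
  ultimately show "lipschitz_between (7/4) 0 2 inner_wt" by (rule lipschitz_between_glue)
qed (auto simp: inner_int_def ramp_def)

lemma profile_outer: "profile 2 outer_wt outer_int (2/3) (7/4)"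
proof (rule profileI)
  fix t
  show "(outer_int has_real_derivative outer_wt t) (at t)"
    unfolding outer_int_def outer_wt_def by (rule derivative_eq_intros refl | simp)+
  assume t: "0 \<le> t" "t \<le> 2"
  consider "t \<le> 67/100" | "67/100 \<le> t" "t \<le> 91/100" | "91/100 \<le> t" by linarith
  then show "0 \<le> outer_wt t \<and> outer_wt t \<le> 2/3"
  proof cases
    case 1
    then have "t * t \<le> 67/100 * (67/100)" using t by (intro mult_mono) auto
    moreover have "0 \<le> t * t" by simp
    ultimately show ?thesis unfolding outer_wt_low[OF 1] power2_eq_square by linarith
  next
    case 2
    have "0 \<le> (t - 13/20) * (21/20 - t)" using 2 by (intro mult_nonneg_nonneg) auto
    then have "(t - 17/20)\<^sup>2 \<le> 1/25" by (simp add: power2_eq_square algebra_simps)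
    then show ?thesis unfolding outer_wt_mid[OF 2] using zero_le_power2[of "t - 17/20"] by linarith
  next
    case 3
    have "0 \<le> (2 - t) * (t - 3/5)" using t 3 by (intro mult_nonneg_nonneg) auto
    moreover have "(2 - t) * (t - 3/5) = 13/5 * t - 6/5 - t\<^sup>2" by (simp add: power2_eq_square field_simps)
    moreover have "(t - 13/10)\<^sup>2 = t\<^sup>2 - 13/5 * t + 169/100" by (simp add: power2_eq_square field_simps)
    moreover have "0 \<le> (t - 13/10)\<^sup>2" by simp
    ultimately show ?thesis unfolding outer_wt_high[OF 3] by linarith
  qed
next
  have "lipschitz_between (7/4) 0 (67/100) outer_wt"
    by (rule lipschitz_between_quadratic[where \<alpha> = "3/4 - 1027/2000" and \<beta> = 0 and \<gamma> = "1/2"]) (auto simp: outer_wt_low)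
  moreover have "lipschitz_between (7/4) (67/100) (91/100) outer_wt"
    by (rule lipschitz_between_quadratic[where \<alpha> = "3/4 - 201/800 - 7/6 * (17/20)\<^sup>2" and \<beta> = "119/60" and \<gamma> = "-7/6"])
      (auto simp: outer_wt_mid power2_eq_square field_simps)
  moreover have "lipschitz_between (7/4) (91/100) 2 outer_wt"
    by (rule lipschitz_between_quadratic[where \<alpha> = "3/4 + 1027/2000" and \<beta> = "-13/10" and \<gamma> = "1/2"]) (auto simp: outer_wt_high)
  ultimately show "lipschitz_between (7/4) 0 2 outer_wt" by (meson lipschitz_between_glue)
qed (auto simp: outer_int_def ramp_def)

text \<open>
  The left-hand side is a cubic polynomial in \<open>w\<close> on this interval, which contains
  \<open>1 - 1/\<surd>3 = 0.4226\<dots>\<close>. Without its error term, \<open>certificate_bound\<close>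
  would force the sum of two such values to be at most \<open>0\<close>.
\<close>

lemma certificate_gain:
  assumes "42/100 \<le> w" "w \<le> 426/1000"
  shows "inner_int w + outer_int (2 - w) - 2 * line_int 1 \<ge> 11/10000"
proof -
  define s where "s = w - 42/100"
  have s: "0 \<le> s" "s \<le> 6/1000" using assms unfolding s_def by auto
  have w: "w = s + 42/100" unfolding s_def by simp
  have "inner_int w + outer_int (2 - w) - 2 * line_int 1 = 793/600000 - 43/2000 * s - 7/20 * s\<^sup>2 - 5/9 * s ^ 3"
    using s unfolding w inner_int_def outer_int_def line_int_def ramp_def
    by (simp add: max_def power2_eq_square power3_eq_cube field_simps)
  moreover have "s\<^sup>2 \<le> (6/1000)\<^sup>2" "s ^ 3 \<le> (6/1000) ^ 3" using s by (auto intro!: power_mono)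
  ultimately show ?thesis using s by (simp add: power2_eq_square power3_eq_cube)
qed

section \<open>The lower bound\<close>

lemma pair_near_inverse_sqrt3:
  fixes x y :: real
  assumes "\<bar>x + y\<bar> \<le> 7/10000" "\<bar>x\<^sup>2 + y\<^sup>2 - 2/3\<bar> \<le> 166/100000"
  shows "\<bar>x\<bar> \<in> {575/1000..579/1000}"
proof -
  have False if "\<bar>x\<bar> < 575/1000"
  proof -
    have "\<bar>y\<bar> \<le> 5757/10000" using that assms(1) by linarith
    then have "y\<^sup>2 \<le> (5757/10000)\<^sup>2" "x\<^sup>2 \<le> (575/1000)\<^sup>2"
      using that by (simp_all only: abs_le_square_iff[symmetric])
    then show False using assms(2) by (simp add: power2_eq_square abs_le_iff)
  qed
  moreover have False if "579/1000 < \<bar>x\<bar>"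
  proof -
    have "5783/10000 \<le> \<bar>y\<bar>" using that assms(1) by linarith
    then have "(5783/10000)\<^sup>2 \<le> y\<^sup>2" "(579/1000)\<^sup>2 \<le> x\<^sup>2"
      using that by (simp_all only: abs_le_square_iff[symmetric])
    then show False using assms(2) by (simp add: power2_eq_square abs_le_iff)
  qed
  ultimately show ?thesis by force
qed

text \<open>
  With this \<open>B\<close> the error term of \<open>certificate_bound\<close> is less than \<open>0.0007\<close> for the piecewise
  quadratic certificate, while \<open>certificate_gain\<close>, applied once for each class, yields at least \<open>0.0022\<close>.
\<close>

lemma (in near_parity_cover) no_near_cover:
  assumes n: "400001 \<le> n" and B: "B = real n / 80000 - 3/2"
  shows False
proof -
  obtain d0 d1 where "gap 0 d0" "gap 1 d1" using gap_exists by blast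
  define d where "d i = (if i = 0 then d0 else d1)" for i :: int
  have gap: "gap i (d i)" if "i \<in> {0, 1}" for i
    using that \<open>gap 0 d0\<close> \<open>gap 1 d1\<close> unfolding d_def by auto
  define a where "a = 2 * real_of_int (d 0) / n"
  define b where "b = 2 * real_of_int (d 1) / n"
  have bound: "HD 0 a + HD 1 b + HS 0 (2 - b) + HS 1 (2 - a) - 4 * G 1 \<le> 7/10000 * M + 13/100000 * L"
    if "profile 1 g G M L" "\<And>i. profile 2 (hD i) (HD i) M L" "\<And>i. profile 2 (hS i) (HS i) M L"
      "\<And>i x y. \<lbrakk>i \<in> {0, 1}; \<bar>x\<bar> \<le> 1; \<bar>y\<bar> \<le> 1\<rbrakk> \<Longrightarrow> hD i \<bar>y - x\<bar> + hS i \<bar>x + y\<bar> \<le> g \<bar>x\<bar> + g \<bar>y\<bar>"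
    for g G :: "real \<Rightarrow> real" and hD HD hS HS :: "int \<Rightarrow> real \<Rightarrow> real" and M L :: real
  proof -
    have M: "0 \<le> M" and L: "0 \<le> L" using profile_M_nonneg[OF that(1)] profile_L_nonneg[OF that(1)] by auto
    have "4 / n * (14 * B * M + 14 * M + 13 * L) = M * (56 * (B + 1) / n) + L * (52 / n)"
      using n by (simp add: field_simps)
    moreover have "56 * (B + 1) / n \<le> 7/10000" using n unfolding B by (simp add: field_simps)
    then have "M * (56 * (B + 1) / n) \<le> M * (7/10000)" using M by (rule mult_left_mono)
    moreover have "52 / real n \<le> 13/100000" using n by (simp add: field_simps)
    then have "L * (52 / n) \<le> L * (13/100000)" using L by (rule mult_left_mono)
    ultimately show ?thesis
      using certificate_bound[of g G M L hD HD hS HS d, OF that gap] n unfolding a_def b_def by linarith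
  qed
  \<comment> \<open>Weight 1 on difference diagonals only, then on sum diagonals only.\<close>
  have "a + b - 2 \<le> 7/10000"
    using bound[of "\<lambda>_. 1/2" "\<lambda>t. 1/2 * t" 1 0 "\<lambda>_ _. 1" "\<lambda>_ t. 1 * t" "\<lambda>_ _. 0" "\<lambda>_ t. 0 * t"]
    by (simp add: profile_const[of "1/2", simplified] profile_const[of 1, simplified] profile_const[of 0, simplified])
  moreover have "2 - a - b \<le> 7/10000"
    using bound[of "\<lambda>_. 1/2" "\<lambda>t. 1/2 * t" 1 0 "\<lambda>_ _. 0" "\<lambda>_ t. 0 * t" "\<lambda>_ _. 1" "\<lambda>_ t. 1 * t"]
    by (simp add: profile_const[of "1/2", simplified] profile_const[of 1, simplified] profile_const[of 0, simplified])
  ultimately have sum: "\<bar>(a - 1) + (b - 1)\<bar> \<le> 7/10000" by linarith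
  have cubes: "a ^ 3 + (2 - a) ^ 3 = 2 + 6 * (a - 1)\<^sup>2" "b ^ 3 + (2 - b) ^ 3 = 2 + 6 * (b - 1)\<^sup>2"
    by (simp_all add: power2_eq_square power3_eq_cube algebra_simps)
  \<comment> \<open>The parallelogram law with a positive sign, then with a negative sign and shifted by 2.\<close>
  have "(a ^ 3 + (2 - a) ^ 3) / 6 + (b ^ 3 + (2 - b) ^ 3) / 6 - 4/3 \<le> 166/100000"
    using bound[of "\<lambda>t. 0 + 1 * t\<^sup>2" "\<lambda>t. 0 * t + 1 * t ^ 3 / 3" 2 2
        "\<lambda>_ t. 0 + 1/2 * t\<^sup>2" "\<lambda>_ t. 0 * t + 1/2 * t ^ 3 / 3" "\<lambda>_ t. 0 + 1/2 * t\<^sup>2" "\<lambda>_ t. 0 * t + 1/2 * t ^ 3 / 3",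
        OF profile_quadratic profile_quadratic profile_quadratic]
    by (simp add: power2_eq_square field_simps)
  moreover have "4/3 - (a ^ 3 + (2 - a) ^ 3) / 6 - (b ^ 3 + (2 - b) ^ 3) / 6 \<le> 166/100000"
    using bound[of "\<lambda>t. 2 + (-1) * t\<^sup>2" "\<lambda>t. 2 * t + (-1) * t ^ 3 / 3" 2 2
        "\<lambda>_ t. 2 + (-1/2) * t\<^sup>2" "\<lambda>_ t. 2 * t + (-1/2) * t ^ 3 / 3" "\<lambda>_ t. 2 + (-1/2) * t\<^sup>2" "\<lambda>_ t. 2 * t + (-1/2) * t ^ 3 / 3",
        OF profile_quadratic profile_quadratic profile_quadratic]
    by (simp add: power2_eq_square field_simps)
  moreover have "\<bar>u + v - 2/3\<bar> \<le> e"
    if "(2 + 6 * u) / 6 + (2 + 6 * v) / 6 - 4/3 \<le> e" "4/3 - (2 + 6 * u) / 6 - (2 + 6 * v) / 6 \<le> e"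
    for u v e :: real using that by (simp add: add_divide_distrib abs_le_iff)
  ultimately have squares: "\<bar>(a - 1)\<^sup>2 + (b - 1)\<^sup>2 - 2/3\<bar> \<le> 166/100000" unfolding cubes by metis
  have range: "\<bar>a - 1\<bar> \<in> {575/1000..579/1000}" by (rule pair_near_inverse_sqrt3[OF sum squares])
  have cert: "(if j = (0::int) then inner_wt else outer_wt) \<bar>y - x\<bar> + (if j = 0 then inner_wt else outer_wt) \<bar>x + y\<bar> \<le> line_wt \<bar>x\<bar> + line_wt \<bar>y\<bar>"
    for j x y
    using even_certificate[where g = line_wt and h = inner_wt and x = x and y = y]
      even_certificate[where g = line_wt and h = outer_wt and x = x and y = y] inner_certificate outer_certificate by auto
  have prof: "profile 2 (if j = (0::int) then inner_wt else outer_wt) (if j = 0 then inner_int else outer_int) (2/3) (7/4)" for j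
    using profile_inner profile_outer by simp
  \<comment> \<open>The class whose difference diagonals stay near the centre receives the inner weight.\<close>
  show False
  proof (cases "a < 1")
    case True
    then have "inner_int a + outer_int (2 - a) - 2 * line_int 1 \<ge> 11/10000" "inner_int (2 - b) + outer_int (2 - (2 - b)) - 2 * line_int 1 \<ge> 11/10000"
      using range sum by (intro certificate_gain; simp add: abs_if split: if_splits)+
    moreover have "inner_int a + outer_int b + inner_int (2 - b) + outer_int (2 - a) - 4 * line_int 1 \<le> 7/10000 * (2/3) + 13/100000 * (7/4)"
      using bound[of line_wt line_int "2/3" "7/4" "\<lambda>i. if i = 0 then inner_wt else outer_wt" "\<lambda>i. if i = 0 then inner_int else outer_int"
          "\<lambda>i. if i = 0 then inner_wt else outer_wt" "\<lambda>i. if i = 0 then inner_int else outer_int", OF profile_line prof prof cert] by simp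
    ultimately show False by simp
  next
    case False
    then have "inner_int b + outer_int (2 - b) - 2 * line_int 1 \<ge> 11/10000" "inner_int (2 - a) + outer_int (2 - (2 - a)) - 2 * line_int 1 \<ge> 11/10000"
      using range sum by (intro certificate_gain; simp add: abs_if split: if_splits)+
    moreover have "outer_int a + inner_int b + outer_int (2 - b) + inner_int (2 - a) - 4 * line_int 1 \<le> 7/10000 * (2/3) + 13/100000 * (7/4)"
      using bound[of line_wt line_int "2/3" "7/4" "\<lambda>i. if 1 - i = 0 then inner_wt else outer_wt" "\<lambda>i. if 1 - i = 0 then inner_int else outer_int"
          "\<lambda>i. if 1 - i = 0 then inner_wt else outer_wt" "\<lambda>i. if 1 - i = 0 then inner_int else outer_int", OF profile_line prof prof cert] by simp
    ultimately show False by simp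
  qed
qed

theorem theorem2p4:
  fixes n :: nat and C :: "(nat \<times> nat) set"
  assumes "n \<ge> 400001"
    and "queen_dominating n C"
  shows "real (card C) + real (delta n C) > c1 * real n - 2"
proof (rule ccontr)
  assume "\<not> real (card C) + real (delta n C) > c1 * real n - 2"
  then have small: "real (card C) + real (delta n C) \<le> real n / 2 + real n / 80000 - 2"
    unfolding c1_def by (simp add: field_simps)
  let ?S = "{max (empty_columns n C p) (empty_rows n C q) |p q. p \<in> {0, 1} \<and> q \<in> {0, 1}}"
  have "?S = (\<lambda>(p, q). max (empty_columns n C p) (empty_rows n C q)) ` ({0, 1} \<times> {0, 1})" by auto
  then have "finite ?S" "?S \<noteq> {}" by auto
  then have "delta n C \<in> ?S" unfolding delta_def by (rule Min_in)
  then obtain p q where pq: "delta n C = max (empty_columns n C p) (empty_rows n C q)" "p < 2" "q < 2" by auto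
  then have "real (empty_columns n C p) \<le> real (delta n C)" "real (empty_rows n C q) \<le> real (delta n C)"
    by simp_all
  then have "real (card C) + real (empty_columns n C p) \<le> (real n - 1) / 2 + (real n / 80000 - 3/2)"
    "real (card C) + real (empty_rows n C q) \<le> (real n - 1) / 2 + (real n / 80000 - 3/2)"
    using small by (simp_all add: field_simps)
  then interpret near_parity_cover n C p q "real n / 80000 - 3/2"
    by unfold_locales (use assms pq in auto)
  show False by (rule no_near_cover[OF assms(1) refl])
qed

end
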